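(* Let $A\in\mathbb{R}^{n\times n}$, $\Lambda_2\in\mathbb{R}^{m\times m}$ and $\Lambda_3\in\mathbb{R}^{p\times p}$ be symmetric positive definite matrices, let $B\in\mathbb{R}^{m\times n}$ and $C\in\mathbb{R}^{p\times m}$ be full row rank matrices, and let $s>0$. Then the LPESS preconditioned matrix $\mathcal{P}_{LPESS}^{-1}\mathcal{A}$ has $n$ repeated eigenvalues equal to $1/s$. The remaining $m+p$ eigenvalues satisfy the following: (1) the real eigenvalues are located in the interval $$\left[\min\left\{\frac{\vartheta_{\min}}{1+s\vartheta_{\min}},\ \frac{\tilde\theta_{\min}}{\vartheta_{\max}+s\tilde\theta_{\min}}\right\},\ \frac{\vartheta_{\max}}{1+s\vartheta_{\max}}\right];$$ (2) if $\lambda$ is any non-real eigenvalue (i.e., $\Im(\lambda)\neq0$), then $$\frac{\vartheta_{\min}}{2+s\vartheta_{\min}}\leq|\lambda|\leq\sqrt{\frac{\tilde\theta_{\max}}{1+s\vartheta_{\min}+s^2\tilde\theta_{\max}}}\quad\text{and}\quad\frac{1}{s\left(1+s\sqrt{\tilde\theta_{\max}}\right)}\leq\left|\lambda-\frac1s\right|\leq\frac{2}{s(2+s\vartheta_{\min})}.$$ Here $\vartheta_{\max}=\lambda_{\max}(\Lambda_2^{-1}Q)$, $\vartheta_{\min}=\lambda_{\min}(\Lambda_2^{-1}Q)$, $\tilde\theta_{\max}=\lambda_{\max}(\Lambda_3^{-1}C\Lambda_2^{-1}C^T)$ and $\tilde\theta_{\min}=\lambda_{\min}(\Lambda_3^{-1}C\Lambda_2^{-1}C^T)$,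 with $Q=BA^{-1}B^T$.
   Context: The saddle point matrix is $\mathcal{A}=\begin{bmatrix}A&B^T&0\\-B&0&-C^T\\0&C&0\end{bmatrix}$. The local PESS (LPESS) preconditioner is $$\mathcal{P}_{LPESS}=\begin{bmatrix}sA&sB^T&0\\-sB&\Lambda_2&-sC^T\\0&sC&\Lambda_3\end{bmatrix}.$$ Eigenvalues are counted with algebraic multiplicity. For a matrix with real eigenvalues, $\lambda_{\max}(\cdot)$ and $\lambda_{\min}(\cdot)$ denote its maximum and minimum eigenvalues. *)

theory Defs
  imports
    "Jordan_Normal_Form.Spectral_Radius"
    "Jordan_Normal_Form.Gauss_Jordan_Elimination"
    "Jordan_Normal_Form.DL_Rank"
    "HOL-Computational_Algebra.Fundamental_Theorem_Algebra"
begin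

definition sym_pos_def :: "nat \<Rightarrow> real mat \<Rightarrow> bool" where
  "sym_pos_def k M \<longleftrightarrow> M \<in> carrier_mat k k \<and> M\<^sup>T = M \<and>
     (\<forall>v \<in> carrier_vec k. v \<noteq> 0\<^sub>v k \<longrightarrow> v \<bullet> (M *\<^sub>v v) > 0)"

text \<open>\<^const>\<open>mat_inverse\<close> returns \<^const>\<open>None\<close> exactly on singular (or non-square) input,
  where \<open>mat_inv\<close> is unspecified.\<close>

definition mat_inv :: "real mat \<Rightarrow> real mat" where
  "mat_inv M = the (mat_inverse M)"

definition full_row_rank :: "nat \<Rightarrow> nat \<Rightarrow> real mat \<Rightarrow> bool" where
  "full_row_rank r c M \<longleftrightarrow> M \<in> carrier_mat r c \<and> vec_space.rank r M = r"

text \<open>The second argument of \<^const>\<open>four_block_mat\<close> below is the block row \<open>(M12 M13)\<close>,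
  written as a degenerate four-block matrix with no lower rows.\<close>

definition block3_mat ::
  "real mat \<Rightarrow> real mat \<Rightarrow> real mat \<Rightarrow> real mat \<Rightarrow> real mat \<Rightarrow> real mat \<Rightarrow>
   real mat \<Rightarrow> real mat \<Rightarrow> real mat \<Rightarrow> real mat" where
  "block3_mat M11 M12 M13 M21 M22 M23 M31 M32 M33 =
     four_block_mat
       M11 (four_block_mat M12 M13 (0\<^sub>m 0 (dim_col M12)) (0\<^sub>m 0 (dim_col M13)))
       (M21 @\<^sub>r M31) (four_block_mat M22 M23 M32 M33)"

definition saddle_mat :: "nat \<Rightarrow> nat \<Rightarrow> nat \<Rightarrow> real mat \<Rightarrow> real mat \<Rightarrow> real mat \<Rightarrow> real mat" where
  "saddle_mat n m p A B C = block3_mat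
     A         (B\<^sup>T)       (0\<^sub>m n p)
     (- B)     (0\<^sub>m m m)   (- C\<^sup>T)
     (0\<^sub>m p n) C           (0\<^sub>m p p)"

definition LPESS_mat :: "nat \<Rightarrow> nat \<Rightarrow> real \<Rightarrow> real mat \<Rightarrow> real mat \<Rightarrow> real mat \<Rightarrow>
    real mat \<Rightarrow> real mat \<Rightarrow> real mat" where
  "LPESS_mat n p s A B C L2 L3 = block3_mat
     (s \<cdot>\<^sub>m A)     (s \<cdot>\<^sub>m B\<^sup>T) (0\<^sub>m n p)
     (- (s \<cdot>\<^sub>m B)) L2         (- (s \<cdot>\<^sub>m C\<^sup>T))
     (0\<^sub>m p n)     (s \<cdot>\<^sub>m C)   L3"

text \<open>All complex eigenvalues of a real matrix, counted with algebraic multiplicity.\<close>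

definition eigvals_mset :: "real mat \<Rightarrow> complex multiset" where
  "eigvals_mset M = proots (char_poly (map_mat complex_of_real M))"

text \<open>Extreme eigenvalues of a matrix whose eigenvalues are all real; note that
  \<^const>\<open>spectrum\<close> of a real matrix contains its real eigenvalues only.\<close>

definition lambda_max :: "real mat \<Rightarrow> real" where
  "lambda_max M = Max (spectrum M)"

definition lambda_min :: "real mat \<Rightarrow> real" where
  "lambda_min M = Min (spectrum M)"

end

theory Submission
  imports Defs
begin

text \<open>Since \<open>P\<close> and the saddle point matrix agree up to the factor \<open>s\<close> on their first block column, the
  preconditioned matrix is block upper triangular with leading block \<open>(1/s) I\<close>; the remaining
  eigenvalues are those of the trailing block. Eliminating the first component of an eigenvector
  \<open>(x, y, u)\<close> and writing \<open>t = 1/\<lambda> - s\<close> leaves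
  \<open>\<Lambda>2 y = t (Q y - C\<^sup>T u)\<close> and \<open>\<Lambda>3 u = t C y\<close>. With \<open>a = y\<^sup>* \<Lambda>2 y\<close>, \<open>b = u\<^sup>* \<Lambda>3 u\<close> and
  \<open>q = y\<^sup>* Q y\<close> this gives \<open>a cnj t = |t|\<^sup>2 q - b t\<close>. For non-real \<open>t\<close> the imaginary part forces
  \<open>a = b\<close>, hence \<open>2 Re t = |t|\<^sup>2 q / a\<close>, and \<open>b \<le> \<theta> |t|\<^sup>2 a\<close> with \<open>\<theta>\<close> the largest eigenvalue of
  \<open>\<Lambda>3\<^sup>-\<^sup>1 C \<Lambda>2\<^sup>-\<^sup>1 C\<^sup>T\<close>; all four modulus estimates follow. For real \<open>t\<close> the identity
  \<open>t q = a + b\<close> gives the upper bound on \<open>\<lambda>\<close>, and a Cauchy-Schwarz argument for \<open>t Q - \<Lambda>2\<close> the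
  lower one.\<close>

section \<open>Extreme eigenvalues of symmetric pencils\<close>

lemma smult_eq_smult_imp:
  fixes a b :: "'a :: field vec"
  assumes "c \<cdot>\<^sub>v a = d \<cdot>\<^sub>v b" "c \<noteq> 0"
  shows "a = (d / c) \<cdot>\<^sub>v b"
proof -
  have "a = (1 / c) \<cdot>\<^sub>v (c \<cdot>\<^sub>v a)" using assms(2) by (simp add: smult_smult_assoc)
  then show ?thesis unfolding assms(1) by (simp add: smult_smult_assoc)
qed

lemma smult_mat_mult_vec:
  fixes M :: "'a :: comm_ring_1 mat"
  assumes "M \<in> carrier_mat r c" "v \<in> carrier_vec c"
  shows "(k \<cdot>\<^sub>m M) *\<^sub>v v = k \<cdot>\<^sub>v (M *\<^sub>v v)"
  using assms by (intro eq_vecI) (auto simp: scalar_prod_def sum_distrib_left mult.assoc)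

lemma mult_mat_zero_vec: "M \<in> carrier_mat r c \<Longrightarrow> M *\<^sub>v 0\<^sub>v c = 0\<^sub>v r"
  by (intro eq_vecI) (auto simp: scalar_prod_def)

lemma transpose_smult_mat: "(k \<cdot>\<^sub>m M)\<^sup>T = k \<cdot>\<^sub>m M\<^sup>T"
  by (intro eq_matI) auto

lemma bilinear_transpose:
  fixes M :: "'a :: comm_ring_1 mat"
  assumes "M \<in> carrier_mat r c" "x \<in> carrier_vec r" "y \<in> carrier_vec c"
  shows "x \<bullet> (M *\<^sub>v y) = y \<bullet> (M\<^sup>T *\<^sub>v x)"
  using transpose_vec_mult_scalar[OF assms(1,3,2)] assms
  by (metis comm_scalar_prod mult_mat_vec_carrier transpose_carrier_mat)

lemma quadratic_form_diff:
  fixes K :: "real mat"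
  assumes K: "K \<in> carrier_mat k k" "K\<^sup>T = K" and x: "x \<in> carrier_vec k" and y: "y \<in> carrier_vec k"
  shows "(a \<cdot>\<^sub>v x - b \<cdot>\<^sub>v y) \<bullet> (K *\<^sub>v (a \<cdot>\<^sub>v x - b \<cdot>\<^sub>v y)) =
    a\<^sup>2 * (x \<bullet> (K *\<^sub>v x)) - 2 * a * b * (x \<bullet> (K *\<^sub>v y)) + b\<^sup>2 * (y \<bullet> (K *\<^sub>v y))"
proof -
  note c = mult_mat_vec_carrier[OF K(1) x] mult_mat_vec_carrier[OF K(1) y]
  have sym: "y \<bullet> (K *\<^sub>v x) = x \<bullet> (K *\<^sub>v y)"
    using bilinear_transpose[OF K(1) y x] K(2) by simp
  have "K *\<^sub>v (a \<cdot>\<^sub>v x - b \<cdot>\<^sub>v y) = a \<cdot>\<^sub>v (K *\<^sub>v x) - b \<cdot>\<^sub>v (K *\<^sub>v y)"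
    using x y by (simp add: mult_minus_distrib_mat_vec[OF K(1)] mult_mat_vec[OF K(1)])
  then show ?thesis
    using x y c
    by (simp add: minus_scalar_prod_distrib[of _ k] scalar_prod_minus_distrib[of _ k]
      sym algebra_simps power2_eq_square)
qed

text \<open>The shifted matrix \<open>S - \<theta> L\<close> at the infimum \<theta> of a Rayleigh
  quotient is semidefinite and singular, so a notion weaker than \<open>sym_pos_def\<close> is
  called for.\<close>

definition sym_psd :: "nat \<Rightarrow> real mat \<Rightarrow> bool" where
  "sym_psd k K \<longleftrightarrow> K \<in> carrier_mat k k \<and> K\<^sup>T = K \<and> (\<forall>v \<in> carrier_vec k. v \<bullet> (K *\<^sub>v v) \<ge> 0)"

lemma sym_pos_def_imp_psd: "sym_pos_def k K \<Longrightarrow> sym_psd k K"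
  unfolding sym_pos_def_def sym_psd_def by (metis mult_mat_vec_carrier order.refl order_less_imp_le scalar_prod_left_zero)

lemma sym_pos_def_injective:
  assumes "sym_pos_def k K" "v \<in> carrier_vec k" "K *\<^sub>v v = 0\<^sub>v k"
  shows "v = 0\<^sub>v k"
  using assms unfolding sym_pos_def_def by (metis less_irrefl scalar_prod_right_zero)

text \<open>The form at \<open>a x - b y\<close> is nonnegative for all scalars; two choices of
  \<open>a\<close> and \<open>b\<close> turn its expansion into a diagonal value times the wanted
  difference. This avoids dividing by a diagonal value, which may vanish.\<close>

lemma psd_cauchy_schwarz:
  assumes K: "sym_psd k K" and x: "x \<in> carrier_vec k" and y: "y \<in> carrier_vec k"
  shows "(x \<bullet> (K *\<^sub>v y))\<^sup>2 \<le> (x \<bullet> (K *\<^sub>v x)) * (y \<bullet> (K *\<^sub>v y))"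
proof -
  let ?X = "x \<bullet> (K *\<^sub>v x)" and ?Y = "y \<bullet> (K *\<^sub>v y)" and ?Z = "x \<bullet> (K *\<^sub>v y)"
  have K': "K \<in> carrier_mat k k" "K\<^sup>T = K" and nn: "\<And>v. v \<in> carrier_vec k \<Longrightarrow> v \<bullet> (K *\<^sub>v v) \<ge> 0"
    using K by (auto simp: sym_psd_def)
  have *: "a\<^sup>2 * ?X - 2 * a * b * ?Z + b\<^sup>2 * ?Y \<ge> 0" for a b
    unfolding quadratic_form_diff[OF K' x y, symmetric] by (intro nn) (use x y in auto)
  have X: "?X \<ge> 0" and Y: "?Y \<ge> 0" using nn x y by auto
  show ?thesis
  proof (cases "?X = 0 \<and> ?Y = 0")
    case True
    \<comment> \<open>With \<open>X = Y = 0\<close> only the cross term survives, and it reads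
      \<open>-2 Z^2 >= 0\<close>.\<close>
    with *[of ?Z 1] show ?thesis by (simp add: power2_eq_square)
  next
    case False
    \<comment> \<open>The two choices factor as \<open>X (X Y - Z^2)\<close> and
      \<open>Y (X Y - Z^2)\<close>; at least one prefactor is positive.\<close>
    from *[of ?Z ?X] have 1: "?X * (?X * ?Y - ?Z\<^sup>2) \<ge> 0"
      by (simp add: power2_eq_square algebra_simps)
    from *[of ?Y ?Z] have 2: "?Y * (?X * ?Y - ?Z\<^sup>2) \<ge> 0"
      by (simp add: power2_eq_square algebra_simps)
    from False X Y have "?X > 0 \<or> ?Y > 0" by auto
    with 1 2 show ?thesis by (auto simp: zero_le_mult_iff)
  qed
qed

section \<open>Comparison of quadratic forms, and inverses of injective matrices\<close>

lemma quadratic_form_bounded: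
  fixes T :: "real mat"
  assumes T: "T \<in> carrier_mat k k"
  obtains c where "c > 0" "\<And>x. x \<in> carrier_vec k \<Longrightarrow> \<bar>x \<bullet> (T *\<^sub>v x)\<bar> \<le> c * (x \<bullet> x)"
proof
  let ?c = "(\<Sum>i<k. \<Sum>j<k. \<bar>T $$ (i,j)\<bar>)"
  have "?c \<ge> 0" by (intro sum_nonneg) auto
  \<comment> \<open>The added 1 keeps the constant positive when \<open>T\<close> is zero.\<close>
  then show "?c + 1 > 0" by simp
  fix x :: "real vec" assume x: "x \<in> carrier_vec k"
  have xx: "x \<bullet> x = (\<Sum>i<k. (x $ i)\<^sup>2)"
    using x by (auto simp: scalar_prod_def power2_eq_square lessThan_atLeast0)
  have sq: "(x $ i)\<^sup>2 \<le> x \<bullet> x" if "i < k" for i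
    unfolding xx using that by (intro member_le_sum) auto
  have prod: "\<bar>x $ i\<bar> * \<bar>x $ j\<bar> \<le> x \<bullet> x" if "i < k" "j < k" for i j
  proof -
    have "2 * (\<bar>x $ i\<bar> * \<bar>x $ j\<bar>) \<le> (x $ i)\<^sup>2 + (x $ j)\<^sup>2"
      using sum_squares_bound[of "\<bar>x $ i\<bar>" "\<bar>x $ j\<bar>"] by simp
    with sq[OF that(1)] sq[OF that(2)] show ?thesis by linarith
  qed
  have "x \<bullet> (T *\<^sub>v x) = (\<Sum>i<k. \<Sum>j<k. T $$ (i,j) * (x $ i * x $ j))"
    using x T by (auto simp: scalar_prod_def lessThan_atLeast0 sum_distrib_left mult_ac intro!: sum.cong)
  also have "\<bar>\<dots>\<bar> \<le> (\<Sum>i<k. \<Sum>j<k. \<bar>T $$ (i,j) * (x $ i * x $ j)\<bar>)"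
    by (rule order_trans[OF sum_abs]) (intro sum_mono sum_abs)
  also have "\<dots> \<le> (\<Sum>i<k. \<Sum>j<k. \<bar>T $$ (i,j)\<bar> * (x \<bullet> x))"
    by (intro sum_mono) (auto simp: abs_mult intro!: mult_left_mono prod)
  also have "\<dots> = ?c * (x \<bullet> x)" by (simp add: sum_distrib_right)
  also have "\<dots> \<le> (?c + 1) * (x \<bullet> x)"
    by (intro mult_right_mono) (auto simp: xx intro: sum_nonneg)
  finally show "\<bar>x \<bullet> (T *\<^sub>v x)\<bar> \<le> (?c + 1) * (x \<bullet> x)" .
qed

text \<open>A trivial kernel means a nonzero determinant, so \<open>mat_inverse\<close> returns
  \<open>Some\<close> and the unspecified value of \<open>mat_inv\<close> is never met.\<close>

lemma mat_inv_injective: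
  assumes K: "K \<in> carrier_mat k k" and inj: "\<And>v. v \<in> carrier_vec k \<Longrightarrow> K *\<^sub>v v = 0\<^sub>v k \<Longrightarrow> v = 0\<^sub>v k"
  shows "mat_inv K \<in> carrier_mat k k" "K * mat_inv K = 1\<^sub>m k" "mat_inv K * K = 1\<^sub>m k"
proof -
  from inj have "det K \<noteq> 0" using det_0_iff_vec_prod_zero_field[OF K] by auto
  from det_non_zero_imp_unit[OF K this, of "()"] mat_inverse(1)[OF K, of "()"]
  obtain G where "mat_inverse K = Some G" by (cases "mat_inverse K") auto
  with mat_inverse(2)[OF K this]
  show "mat_inv K \<in> carrier_mat k k" "K * mat_inv K = 1\<^sub>m k" "mat_inv K * K = 1\<^sub>m k"
    by (auto simp: mat_inv_def)
qed

lemma mat_inv_cancel: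
  assumes K: "K \<in> carrier_mat k k" and inj: "\<And>v. v \<in> carrier_vec k \<Longrightarrow> K *\<^sub>v v = 0\<^sub>v k \<Longrightarrow> v = 0\<^sub>v k"
    and v: "v \<in> carrier_vec k"
  shows "K *\<^sub>v (mat_inv K *\<^sub>v v) = v" "mat_inv K *\<^sub>v (K *\<^sub>v v) = v"
  using mat_inv_injective[OF K inj] K v by (simp_all flip: assoc_mult_mat_vec)

text \<open>An injective semidefinite \<open>K\<close> is coercive: Cauchy-Schwarz against
  \<open>mat_inv K x\<close> bounds the square of \<open>x \<bullet> x\<close> by the form of
  \<open>K\<close> times the form of \<open>mat_inv K\<close>, and the latter is at most a multiple
  of \<open>x \<bullet> x\<close>. The form of any \<open>T\<close> is in turn bounded by a multiple
  of \<open>x \<bullet> x\<close>.\<close>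

lemma psd_injective_dominates:
  assumes K: "sym_psd k K" and inj: "\<And>v. v \<in> carrier_vec k \<Longrightarrow> K *\<^sub>v v = 0\<^sub>v k \<Longrightarrow> v = 0\<^sub>v k"
    and T: "T \<in> carrier_mat k k"
  obtains c where "c > 0" "\<And>x. x \<in> carrier_vec k \<Longrightarrow> \<bar>x \<bullet> (T *\<^sub>v x)\<bar> \<le> c * (x \<bullet> (K *\<^sub>v x))"
proof -
  have Kc: "K \<in> carrier_mat k k" using K by (simp add: sym_psd_def)
  let ?G = "mat_inv K"
  note G = mat_inv_injective[OF Kc inj]
  obtain c where c: "c > 0" "\<And>x. x \<in> carrier_vec k \<Longrightarrow> \<bar>x \<bullet> (?G *\<^sub>v x)\<bar> \<le> c * (x \<bullet> x)"
    using quadratic_form_bounded[OF G(1)] by blast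
  obtain d where d: "d > 0" "\<And>x. x \<in> carrier_vec k \<Longrightarrow> \<bar>x \<bullet> (T *\<^sub>v x)\<bar> \<le> d * (x \<bullet> x)"
    using quadratic_form_bounded[OF T] by blast
  have coercive: "x \<bullet> x \<le> c * (x \<bullet> (K *\<^sub>v x))" if x: "x \<in> carrier_vec k" for x
  proof (cases "x \<bullet> x = 0")
    case True
    then show ?thesis using K x c(1) by (auto simp: sym_psd_def)
  next
    case False
    have nn: "x \<bullet> (K *\<^sub>v x) \<ge> 0" using K x by (auto simp: sym_psd_def)
    have xx: "x \<bullet> x > 0" using False by (simp add: scalar_prod_def less_le sum_nonneg)
    have Gx: "?G *\<^sub>v x \<in> carrier_vec k" using G(1) x by simp
    \<comment> \<open>With \<open>y = ?G x\<close> one has \<open>K y = x\<close>, so the mixed term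
      is \<open>x \<bullet> x\<close> and the form at \<open>y\<close> is
      \<open>y \<bullet> x\<close>.\<close>
    have "(x \<bullet> x)\<^sup>2 \<le> (x \<bullet> (K *\<^sub>v x)) * ((?G *\<^sub>v x) \<bullet> x)"
      using psd_cauchy_schwarz[OF K x Gx] mat_inv_cancel[OF Kc inj x] by simp
    also have "(?G *\<^sub>v x) \<bullet> x = x \<bullet> (?G *\<^sub>v x)" using Gx x by (rule comm_scalar_prod)
    also have "(x \<bullet> (K *\<^sub>v x)) * \<dots> \<le> (x \<bullet> (K *\<^sub>v x)) * (c * (x \<bullet> x))"
      using c(2)[OF x] nn by (intro mult_left_mono) auto
    finally show ?thesis using xx by (simp add: power2_eq_square mult.commute)
  qed
  show ?thesis
  proof (rule that[of "d * c"])
    show "d * c > 0" using c d by simp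
    fix x :: "real vec" assume x: "x \<in> carrier_vec k"
    have "\<bar>x \<bullet> (T *\<^sub>v x)\<bar> \<le> d * (x \<bullet> x)" by (rule d(2)[OF x])
    also have "\<dots> \<le> d * (c * (x \<bullet> (K *\<^sub>v x)))" using coercive[OF x] d(1) by simp
    finally show "\<bar>x \<bullet> (T *\<^sub>v x)\<bar> \<le> d * c * (x \<bullet> (K *\<^sub>v x))" by (simp add: mult.assoc)
  qed
qed

text \<open>If the infimum \<open>\<theta>\<close> of the Rayleigh quotient were not an eigenvalue, \<open>S - \<theta> L\<close> would be
  injective and positive semidefinite, so it would dominate a positive multiple of \<open>L\<close> and
  \<open>\<theta>\<close> could be increased. This replaces the usual compactness argument.\<close>

lemma min_generalized_eigenvalue:
  assumes L: "sym_pos_def k L" and S: "S \<in> carrier_mat k k" "S\<^sup>T = S" and k: "k > 0"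
  obtains \<theta> v where "v \<in> carrier_vec k" "v \<noteq> 0\<^sub>v k" "S *\<^sub>v v = \<theta> \<cdot>\<^sub>v (L *\<^sub>v v)"
    "\<And>x. x \<in> carrier_vec k \<Longrightarrow> \<theta> * (x \<bullet> (L *\<^sub>v x)) \<le> x \<bullet> (S *\<^sub>v x)"
proof -
  have Lc: "L \<in> carrier_mat k k" "L\<^sup>T = L" and Lpos: "\<And>v. v \<in> carrier_vec k \<Longrightarrow> v \<noteq> 0\<^sub>v k \<Longrightarrow> v \<bullet> (L *\<^sub>v v) > 0"
    using L by (auto simp: sym_pos_def_def)
  note Linj = sym_pos_def_injective[OF L]
  obtain c where c: "c > 0" "\<And>x. x \<in> carrier_vec k \<Longrightarrow> \<bar>x \<bullet> (S *\<^sub>v x)\<bar> \<le> c * (x \<bullet> (L *\<^sub>v x))"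
    using psd_injective_dominates[OF sym_pos_def_imp_psd[OF L] Linj S(1)] by blast
  define R where "R = {(x \<bullet> (S *\<^sub>v x)) / (x \<bullet> (L *\<^sub>v x)) | x. x \<in> carrier_vec k \<and> x \<noteq> 0\<^sub>v k}"
  have Rne: "R \<noteq> {}"
  proof -
    \<comment> \<open>Here \<open>k > 0\<close> enters: the infimum has to range over a nonempty
      set.\<close>
    have "unit_vec k 0 \<in> carrier_vec k" "(unit_vec k 0 :: real vec) \<noteq> 0\<^sub>v k" using k by auto
    then show ?thesis unfolding R_def by blast
  qed
  have "- c \<le> r" if "r \<in> R" for r
  proof -
    from that obtain x where x: "x \<in> carrier_vec k" "x \<noteq> 0\<^sub>v k"
      and r: "r = (x \<bullet> (S *\<^sub>v x)) / (x \<bullet> (L *\<^sub>v x))" unfolding R_def by blast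
    from c(2)[OF x(1)] Lpos[OF x] show ?thesis unfolding r by (simp add: field_simps)
  qed
  then have Rbdd: "bdd_below R" by (meson bdd_belowI)
  define \<theta> where "\<theta> = Inf R"
  have low: "\<theta> * (x \<bullet> (L *\<^sub>v x)) \<le> x \<bullet> (S *\<^sub>v x)" if x: "x \<in> carrier_vec k" for x
  proof (cases "x = 0\<^sub>v k")
    case True
    then show ?thesis using S(1) Lc(1) by (simp add: mult_mat_vec_carrier[THEN scalar_prod_left_zero])
  next
    case False
    then have "\<theta> \<le> (x \<bullet> (S *\<^sub>v x)) / (x \<bullet> (L *\<^sub>v x))"
      unfolding \<theta>_def using x by (intro cInf_lower Rbdd) (auto simp: R_def)
    then show ?thesis using Lpos[OF x False] by (simp add: field_simps)
  qed
  define K where "K = S - \<theta> \<cdot>\<^sub>m L"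
  have Kc: "K \<in> carrier_mat k k" "K\<^sup>T = K"
    unfolding K_def using S Lc transpose_minus[of S k k] by (auto simp: transpose_smult_mat)
  have Kv: "K *\<^sub>v v = S *\<^sub>v v - \<theta> \<cdot>\<^sub>v (L *\<^sub>v v)" if "v \<in> carrier_vec k" for v
    unfolding K_def using that S(1) Lc(1)
    by (simp add: minus_mult_distrib_mat_vec[of _ k k] smult_mat_mult_vec)
  have Kform: "v \<bullet> (K *\<^sub>v v) = v \<bullet> (S *\<^sub>v v) - \<theta> * (v \<bullet> (L *\<^sub>v v))" if v: "v \<in> carrier_vec k" for v
    using v S(1) Lc(1) by (simp add: Kv scalar_prod_minus_distrib[of _ k])
  have Kpsd: "sym_psd k K"
    unfolding sym_psd_def using Kc low by (simp add: Kform)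
  have "\<exists>v \<in> carrier_vec k. v \<noteq> 0\<^sub>v k \<and> K *\<^sub>v v = 0\<^sub>v k"
  proof (rule ccontr)
    assume "\<not> ?thesis"
    then obtain d where d: "d > 0" "\<And>x. x \<in> carrier_vec k \<Longrightarrow> \<bar>x \<bullet> (L *\<^sub>v x)\<bar> \<le> d * (x \<bullet> (K *\<^sub>v x))"
      using psd_injective_dominates[OF Kpsd _ Lc(1)] by blast
    \<comment> \<open>Domination of \<open>L\<close> by \<open>d K\<close> with
      \<open>K = S - \<theta> L\<close> says that every Rayleigh quotient exceeds \<theta> by at
      least \<open>1 / d\<close>, against the choice of \<theta> as infimum.\<close>
    have "\<theta> + 1 / d \<le> r" if "r \<in> R" for r
    proof -
      from that obtain x where x: "x \<in> carrier_vec k" "x \<noteq> 0\<^sub>v k"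
        and r: "r = (x \<bullet> (S *\<^sub>v x)) / (x \<bullet> (L *\<^sub>v x))" unfolding R_def by blast
      have "x \<bullet> (L *\<^sub>v x) \<le> d * (x \<bullet> (S *\<^sub>v x) - \<theta> * (x \<bullet> (L *\<^sub>v x)))"
        using d(2)[OF x(1)] Kform[OF x(1)] by simp
      then show ?thesis unfolding r using Lpos[OF x] d(1) by (simp add: field_simps)
    qed
    then have "\<theta> + 1 / d \<le> \<theta>" unfolding \<theta>_def using Rne by (intro cInf_greatest) auto
    with d(1) show False by simp
  qed
  then obtain v where v: "v \<in> carrier_vec k" "v \<noteq> 0\<^sub>v k" "K *\<^sub>v v = 0\<^sub>v k" by blast
  have "S *\<^sub>v v = (S *\<^sub>v v - \<theta> \<cdot>\<^sub>v (L *\<^sub>v v)) + \<theta> \<cdot>\<^sub>v (L *\<^sub>v v)"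
    using v(1) S(1) Lc(1) by (intro eq_vecI) auto
  also have "\<dots> = \<theta> \<cdot>\<^sub>v (L *\<^sub>v v)"
    unfolding Kv[OF v(1), symmetric] v(3) using v(1) Lc(1) by simp
  finally have "S *\<^sub>v v = \<theta> \<cdot>\<^sub>v (L *\<^sub>v v)" .
  with v low show thesis using that by blast
qed

section \<open>The spectrum of \<open>mat_inv L * S\<close>, read off the symmetric pencil of
  \<open>S\<close> and \<open>L\<close>\<close>

lemma eigenvalue_mat_inv_mult:
  assumes L: "sym_pos_def k L" and S: "S \<in> carrier_mat k k"
  shows "eigenvalue (mat_inv L * S) e \<longleftrightarrow>
    (\<exists>v \<in> carrier_vec k. v \<noteq> 0\<^sub>v k \<and> S *\<^sub>v v = e \<cdot>\<^sub>v (L *\<^sub>v v))"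
proof -
  have Lc: "L \<in> carrier_mat k k" using L by (simp add: sym_pos_def_def)
  note inj = sym_pos_def_injective[OF L]
  note G = mat_inv_injective[OF Lc inj]
  have iff: "(mat_inv L * S) *\<^sub>v v = e \<cdot>\<^sub>v v \<longleftrightarrow> S *\<^sub>v v = e \<cdot>\<^sub>v (L *\<^sub>v v)" if v: "v \<in> carrier_vec k" for v
  proof -
    have Sv: "S *\<^sub>v v \<in> carrier_vec k" using S v by simp
    have "(mat_inv L * S) *\<^sub>v v = mat_inv L *\<^sub>v (S *\<^sub>v v)" using G(1) S v by simp
    moreover have "S *\<^sub>v v = e \<cdot>\<^sub>v (L *\<^sub>v v)" if "mat_inv L *\<^sub>v (S *\<^sub>v v) = e \<cdot>\<^sub>v v"
      using arg_cong[OF that, of "\<lambda>w. L *\<^sub>v w"] mat_inv_cancel(1)[OF Lc inj Sv] mult_mat_vec[OF Lc v]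
      by simp
    moreover have "mat_inv L *\<^sub>v (S *\<^sub>v v) = e \<cdot>\<^sub>v v" if "S *\<^sub>v v = e \<cdot>\<^sub>v (L *\<^sub>v v)"
      using mat_inv_cancel(2)[OF Lc inj v] mult_mat_vec[OF G(1), of "L *\<^sub>v v"] Lc v by (simp add: that)
    ultimately show ?thesis by metis
  qed
  have dim: "dim_row (mat_inv L * S) = k" using G(1) by simp
  show ?thesis unfolding eigenvalue_def eigenvector_def dim Bex_def using iff by blast
qed

text \<open>The least Rayleigh quotient is itself an eigenvalue of \<open>mat_inv L * S\<close>, and
  testing it on the other eigenvectors shows that it is the smallest, hence the \<open>Min\<close>.
  In dimension 0 both sides vanish, whatever \<open>lambda_min\<close> is.\<close>

lemma lambda_min_le_form:
  assumes L: "sym_pos_def k L" and S: "S \<in> carrier_mat k k" "S\<^sup>T = S" and x: "x \<in> carrier_vec k"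
  shows "lambda_min (mat_inv L * S) * (x \<bullet> (L *\<^sub>v x)) \<le> x \<bullet> (S *\<^sub>v x)"
proof (cases "k = 0")
  case True
  then show ?thesis using x L S by (simp add: sym_pos_def_def scalar_prod_def)
next
  case False
  have Lc: "L \<in> carrier_mat k k" using L by (simp add: sym_pos_def_def)
  have E: "mat_inv L * S \<in> carrier_mat k k"
    using mat_inv_injective(1)[OF Lc sym_pos_def_injective[OF L]] S(1) by simp
  obtain \<theta> v where v: "v \<in> carrier_vec k" "v \<noteq> 0\<^sub>v k" "S *\<^sub>v v = \<theta> \<cdot>\<^sub>v (L *\<^sub>v v)"
    and low: "\<And>x. x \<in> carrier_vec k \<Longrightarrow> \<theta> * (x \<bullet> (L *\<^sub>v x)) \<le> x \<bullet> (S *\<^sub>v x)"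
    using min_generalized_eigenvalue[OF L S] False by blast
  have "lambda_min (mat_inv L * S) = \<theta>" unfolding lambda_min_def
  proof (rule Min_eqI)
    show "finite (spectrum (mat_inv L * S))" by (rule card_finite_spectrum[OF E])
    show "\<theta> \<in> spectrum (mat_inv L * S)"
      unfolding spectrum_def using v eigenvalue_mat_inv_mult[OF L S(1)] by auto
    fix e assume "e \<in> spectrum (mat_inv L * S)"
    then obtain w where w: "w \<in> carrier_vec k" "w \<noteq> 0\<^sub>v k" "S *\<^sub>v w = e \<cdot>\<^sub>v (L *\<^sub>v w)"
      unfolding spectrum_def using eigenvalue_mat_inv_mult[OF L S(1)] by auto
    have "w \<bullet> (L *\<^sub>v w) > 0" using L w by (auto simp: sym_pos_def_def)
    moreover have "\<theta> * (w \<bullet> (L *\<^sub>v w)) \<le> e * (w \<bullet> (L *\<^sub>v w))"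
      using low[OF w(1)] w Lc by simp
    ultimately show "\<theta> \<le> e" by simp
  qed
  then show ?thesis using low[OF x] by simp
qed

text \<open>The minimum problem for \<open>- S\<close> yields the maximum for \<open>S\<close> after
  a change of sign.\<close>

lemma form_le_lambda_max:
  assumes L: "sym_pos_def k L" and S: "S \<in> carrier_mat k k" "S\<^sup>T = S" and x: "x \<in> carrier_vec k"
  shows "x \<bullet> (S *\<^sub>v x) \<le> lambda_max (mat_inv L * S) * (x \<bullet> (L *\<^sub>v x))"
proof (cases "k = 0")
  case True
  then show ?thesis using x L S by (simp add: sym_pos_def_def scalar_prod_def)
next
  case False
  have Lc: "L \<in> carrier_mat k k" using L by (simp add: sym_pos_def_def)
  have E: "mat_inv L * S \<in> carrier_mat k k"
    using mat_inv_injective(1)[OF Lc sym_pos_def_injective[OF L]] S(1) by simp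
  have neg: "- S \<in> carrier_mat k k" "(- S)\<^sup>T = - S" using S by (auto simp: transpose_uminus)
  have negv: "(- S) *\<^sub>v v = - (S *\<^sub>v v)" "v \<bullet> (- (S *\<^sub>v v)) = - (v \<bullet> (S *\<^sub>v v))"
    if "v \<in> carrier_vec k" for v
    using that S(1) by auto
  obtain \<theta> v where v: "v \<in> carrier_vec k" "v \<noteq> 0\<^sub>v k" "(- S) *\<^sub>v v = \<theta> \<cdot>\<^sub>v (L *\<^sub>v v)"
    and low: "\<And>x. x \<in> carrier_vec k \<Longrightarrow> \<theta> * (x \<bullet> (L *\<^sub>v x)) \<le> x \<bullet> ((- S) *\<^sub>v x)"
    using min_generalized_eigenvalue[OF L neg] False by blast
  have Sv: "S *\<^sub>v v = (- \<theta>) \<cdot>\<^sub>v (L *\<^sub>v v)"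
  proof -
    have "S *\<^sub>v v = - (- (S *\<^sub>v v))" by simp
    also have "\<dots> = - (\<theta> \<cdot>\<^sub>v (L *\<^sub>v v))" using v negv by simp
    also have "\<dots> = (- \<theta>) \<cdot>\<^sub>v (L *\<^sub>v v)" by (intro eq_vecI) auto
    finally show ?thesis .
  qed
  have "lambda_max (mat_inv L * S) = - \<theta>" unfolding lambda_max_def
  proof (rule Max_eqI)
    show "finite (spectrum (mat_inv L * S))" by (rule card_finite_spectrum[OF E])
    show "- \<theta> \<in> spectrum (mat_inv L * S)"
      unfolding spectrum_def using v Sv eigenvalue_mat_inv_mult[OF L S(1)] by auto
    fix e assume "e \<in> spectrum (mat_inv L * S)"
    then obtain w where w: "w \<in> carrier_vec k" "w \<noteq> 0\<^sub>v k" "S *\<^sub>v w = e \<cdot>\<^sub>v (L *\<^sub>v w)"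
      unfolding spectrum_def using eigenvalue_mat_inv_mult[OF L S(1)] by auto
    have "w \<bullet> (L *\<^sub>v w) > 0" using L w by (auto simp: sym_pos_def_def)
    moreover have "e * (w \<bullet> (L *\<^sub>v w)) \<le> - \<theta> * (w \<bullet> (L *\<^sub>v w))"
      using low[OF w(1)] w Lc negv[OF w(1)] by simp
    ultimately show "e \<le> - \<theta>" by (simp only: mult_le_cancel_right_pos)
  qed
  then show ?thesis using low[OF x] negv[OF x] by simp
qed

text \<open>For \<open>k > 0\<close> the spectrum is nonempty, so \<open>lambda_min\<close> has an
  eigenvector \<open>w\<close>; it is then the quotient of two positive forms at
  \<open>w\<close>.\<close>

lemma lambda_min_pos:
  assumes L: "sym_pos_def k L" and S: "sym_pos_def k S" and k: "k > 0"
  shows "lambda_min (mat_inv L * S) > 0"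
proof -
  have Lc: "L \<in> carrier_mat k k" and Sc: "S \<in> carrier_mat k k" "S\<^sup>T = S"
    using L S by (auto simp: sym_pos_def_def)
  have E: "mat_inv L * S \<in> carrier_mat k k"
    using mat_inv_injective(1)[OF Lc sym_pos_def_injective[OF L]] Sc by simp
  obtain \<theta> v where "v \<in> carrier_vec k" "v \<noteq> 0\<^sub>v k" "S *\<^sub>v v = \<theta> \<cdot>\<^sub>v (L *\<^sub>v v)"
    using min_generalized_eigenvalue[OF L Sc k] by blast
  then have "\<theta> \<in> spectrum (mat_inv L * S)"
    unfolding spectrum_def using eigenvalue_mat_inv_mult[OF L Sc(1)] by auto
  then have "lambda_min (mat_inv L * S) \<in> spectrum (mat_inv L * S)"
    unfolding lambda_min_def using card_finite_spectrum(1)[OF E] by (intro Min_in) auto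
  then obtain w where w: "w \<in> carrier_vec k" "w \<noteq> 0\<^sub>v k"
    "S *\<^sub>v w = lambda_min (mat_inv L * S) \<cdot>\<^sub>v (L *\<^sub>v w)"
    unfolding spectrum_def using eigenvalue_mat_inv_mult[OF L Sc(1)] by auto
  have "w \<bullet> (L *\<^sub>v w) > 0" "w \<bullet> (S *\<^sub>v w) > 0" using L S w by (auto simp: sym_pos_def_def)
  moreover have "w \<bullet> (S *\<^sub>v w) = lambda_min (mat_inv L * S) * (w \<bullet> (L *\<^sub>v w))"
    using w Lc by simp
  ultimately show ?thesis by (simp add: zero_less_mult_iff)
qed

section \<open>Definiteness of inverses and of congruences\<close>

lemma sym_pos_def_mat_inv:
  assumes K: "sym_pos_def k K"
  shows "sym_pos_def k (mat_inv K)"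
proof -
  have Kc: "K \<in> carrier_mat k k" "K\<^sup>T = K" using K by (auto simp: sym_pos_def_def)
  note inj = sym_pos_def_injective[OF K]
  note G = mat_inv_injective[OF Kc(1) inj]
  have "(mat_inv K)\<^sup>T = (mat_inv K)\<^sup>T * (K * mat_inv K)" using G by simp
  also have "\<dots> = ((mat_inv K)\<^sup>T * K) * mat_inv K" using G(1) Kc(1) by simp
  also have "(mat_inv K)\<^sup>T * K = (K * mat_inv K)\<^sup>T"
    using transpose_mult[OF Kc(1) G(1)] Kc(2) by simp
  also have "\<dots> * mat_inv K = mat_inv K" using G by simp
  finally have sym: "(mat_inv K)\<^sup>T = mat_inv K" .
  have "v \<bullet> (mat_inv K *\<^sub>v v) > 0" if v: "v \<in> carrier_vec k" "v \<noteq> 0\<^sub>v k" for v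
  proof -
    let ?g = "mat_inv K *\<^sub>v v"
    have g: "?g \<in> carrier_vec k" using G(1) v by simp
    have Kg: "K *\<^sub>v ?g = v" by (rule mat_inv_cancel(1)[OF Kc(1) inj v(1)])
    have "?g \<noteq> 0\<^sub>v k" using Kg v(2) mult_mat_zero_vec[OF Kc(1)] by metis
    then have "?g \<bullet> (K *\<^sub>v ?g) > 0" using K g by (auto simp: sym_pos_def_def)
    then show ?thesis unfolding Kg using comm_scalar_prod[OF g v(1)] by simp
  qed
  with sym G(1) show ?thesis by (simp add: sym_pos_def_def)
qed

text \<open>A maximal independent set of columns has \<open>r\<close> elements and so is a basis of
  the whole space. Hence \<open>v = M x\<close> for some \<open>x\<close>, and
  \<open>v \<bullet> v = x \<bullet> (M\<^sup>T v) = 0\<close>.\<close>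

lemma full_row_rank_transpose_injective:
  assumes M: "full_row_rank r c M" and v: "v \<in> carrier_vec r" "M\<^sup>T *\<^sub>v v = 0\<^sub>v c"
  shows "v = 0\<^sub>v r"
proof -
  interpret vec_space "TYPE(real)" r .
  have Mc: "M \<in> carrier_mat r c" and rk: "rank M = r" using M by (auto simp: full_row_rank_def)
  have cols: "set (cols M) \<subseteq> carrier_vec r" using Mc cols_dim by blast
  obtain S where S: "maximal S (\<lambda>T. T \<subseteq> set (cols M) \<and> lin_indpt T)"
    using maximal_exists_superset[of "set (cols M)" "\<lambda>T. T \<subseteq> set (cols M) \<and> lin_indpt T" "{}"]
    by (auto simp: lin_dep_def)
  then have S': "S \<subseteq> set (cols M)" "lin_indpt S" by (auto simp: maximal_def)
  have "card S = r" using rank_card_indpt[OF Mc S] rk by simp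
  moreover have "finite S" using S'(1) finite_subset by blast
  ultimately have "basis S"
    using S' cols by (intro dim_li_is_basis fin_dim) (auto simp: dim_is_n)
  then have "v \<in> span S" using v(1) by (auto simp: basis_def)
  then have "v \<in> col_space M" unfolding col_space_def using span_is_monotone[OF S'(1)] by blast
  then obtain x where x: "x \<in> carrier_vec c" "M *\<^sub>v x = v" using col_space_eq[OF Mc] Mc by auto
  have "v \<bullet> v = x \<bullet> (M\<^sup>T *\<^sub>v v)" using bilinear_transpose[OF Mc v(1) x(1)] x(2) by simp
  also have "\<dots> = 0" using v(2) x(1) by simp
  finally show ?thesis using conjugate_square_eq_0_vec[OF v(1)] by simp
qed

text \<open>The form at \<open>v\<close> is the form of \<open>K\<close> at
  \<open>M\<^sup>T v\<close>, which is nonzero by full row rank. Both \<open>Q\<close> and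
  \<open>C \<Lambda>2\<^sup>-\<^sup>1 C\<^sup>T\<close> are instances.\<close>

lemma sym_pos_def_congruence:
  assumes K: "sym_pos_def c K" and M: "full_row_rank r c M"
  shows "sym_pos_def r (M * K * M\<^sup>T)"
proof -
  have Kc: "K \<in> carrier_mat c c" "K\<^sup>T = K" and Mc: "M \<in> carrier_mat r c"
    using K M by (auto simp: sym_pos_def_def full_row_rank_def)
  have "(M * K * M\<^sup>T)\<^sup>T = M * (M * K)\<^sup>T"
    using transpose_mult[of "M * K" r c "M\<^sup>T" r] Kc Mc by simp
  also have "\<dots> = M * K * M\<^sup>T" using transpose_mult[OF Mc Kc(1)] Kc Mc by simp
  finally have sym: "(M * K * M\<^sup>T)\<^sup>T = M * K * M\<^sup>T" .
  have "v \<bullet> ((M * K * M\<^sup>T) *\<^sub>v v) > 0" if v: "v \<in> carrier_vec r" "v \<noteq> 0\<^sub>v r" for v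
  proof -
    have g: "M\<^sup>T *\<^sub>v v \<in> carrier_vec c" using Mc v by simp
    have "M\<^sup>T *\<^sub>v v \<noteq> 0\<^sub>v c" using full_row_rank_transpose_injective[OF M v(1)] v(2) by blast
    then have pos: "(M\<^sup>T *\<^sub>v v) \<bullet> (K *\<^sub>v (M\<^sup>T *\<^sub>v v)) > 0" using K g by (auto simp: sym_pos_def_def)
    have "(M * K * M\<^sup>T) *\<^sub>v v = M *\<^sub>v (K *\<^sub>v (M\<^sup>T *\<^sub>v v))"
      using assoc_mult_mat_vec[of "M * K" r c "M\<^sup>T" r v] assoc_mult_mat_vec[of M r c K c] Kc Mc v g
      by simp
    also have "v \<bullet> \<dots> = (K *\<^sub>v (M\<^sup>T *\<^sub>v v)) \<bullet> (M\<^sup>T *\<^sub>v v)"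
      using bilinear_transpose[OF Mc v(1)] Kc g by simp
    also have "\<dots> = (M\<^sup>T *\<^sub>v v) \<bullet> (K *\<^sub>v (M\<^sup>T *\<^sub>v v))"
      using Kc g by (intro comm_scalar_prod[of _ c]) auto
    finally show ?thesis using pos by simp
  qed
  with sym Kc Mc show ?thesis by (simp add: sym_pos_def_def)
qed

section \<open>Real matrices acting on complex and on block vectors\<close>

text \<open>The mixed terms in real and imaginary parts only enter the imaginary part, where
  symmetry of \<open>K\<close> cancels them. Real bounds on forms thereby carry over to complex
  vectors.\<close>

lemma hermitian_form_real_mat:
  fixes K :: "real mat" and y :: "complex vec"
  assumes K: "K \<in> carrier_mat k k" "K\<^sup>T = K" and y: "y \<in> carrier_vec k"
  shows "conjugate y \<bullet> (map_mat complex_of_real K *\<^sub>v y) = complex_of_real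
    (map_vec Re y \<bullet> (K *\<^sub>v map_vec Re y) + map_vec Im y \<bullet> (K *\<^sub>v map_vec Im y))"
proof -
  let ?x = "map_vec Re y" and ?z = "map_vec Im y"
  let ?f = "\<lambda>v w. \<Sum>i<k. \<Sum>j<k. v $ i * (K $$ (i,j) * w $ j)"
  have form: "v \<bullet> (K *\<^sub>v w) = ?f v w" if "v \<in> carrier_vec k" "w \<in> carrier_vec k" for v w
    using that K(1) by (auto simp: scalar_prod_def lessThan_atLeast0 sum_distrib_left intro!: sum.cong)
  have "?x \<bullet> (K *\<^sub>v ?z) = ?z \<bullet> (K *\<^sub>v ?x)"
    using bilinear_transpose[OF K(1), of ?x ?z] K(2) y by simp
  then have sym: "?f ?x ?z = ?f ?z ?x" using form y by simp
  have "conjugate y \<bullet> (map_mat complex_of_real K *\<^sub>v y)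
    = (\<Sum>i<k. \<Sum>j<k. cnj (y $ i) * (complex_of_real (K $$ (i,j)) * y $ j))"
    using y K(1) by (auto simp: scalar_prod_def lessThan_atLeast0 sum_distrib_left intro!: sum.cong)
  also have "\<dots> = complex_of_real (?f ?x ?x + ?f ?z ?z)"
  proof (rule complex_eqI)
    have "Re (\<Sum>i<k. \<Sum>j<k. cnj (y $ i) * (complex_of_real (K $$ (i,j)) * y $ j))
      = (\<Sum>i<k. \<Sum>j<k. ?x $ i * (K $$ (i,j) * ?x $ j) + ?z $ i * (K $$ (i,j) * ?z $ j))"
      using y unfolding Re_sum by (intro sum.cong refl) (simp add: algebra_simps)
    then show "Re (\<Sum>i<k. \<Sum>j<k. cnj (y $ i) * (complex_of_real (K $$ (i,j)) * y $ j))
      = Re (complex_of_real (?f ?x ?x + ?f ?z ?z))"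
      by (simp add: sum.distrib)
    have "Im (\<Sum>i<k. \<Sum>j<k. cnj (y $ i) * (complex_of_real (K $$ (i,j)) * y $ j))
      = (\<Sum>i<k. \<Sum>j<k. ?x $ i * (K $$ (i,j) * ?z $ j) - ?z $ i * (K $$ (i,j) * ?x $ j))"
      using y unfolding Im_sum by (intro sum.cong refl) (simp add: algebra_simps)
    also have "\<dots> = ?f ?x ?z - ?f ?z ?x" by (simp add: sum_subtractf)
    finally show "Im (\<Sum>i<k. \<Sum>j<k. cnj (y $ i) * (complex_of_real (K $$ (i,j)) * y $ j))
      = Im (complex_of_real (?f ?x ?x + ?f ?z ?z))" using sym by (simp only: Im_complex_of_real)
  qed
  finally show ?thesis using y by (simp add: form)
qed

lemma map_vec_Re_Im_mult:
  fixes M :: "real mat" and y :: "complex vec"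
  assumes "M \<in> carrier_mat r c" "y \<in> carrier_vec c"
  shows "map_vec Re (map_mat complex_of_real M *\<^sub>v y) = M *\<^sub>v map_vec Re y"
    "map_vec Im (map_mat complex_of_real M *\<^sub>v y) = M *\<^sub>v map_vec Im y"
proof -
  show "map_vec Re (map_mat complex_of_real M *\<^sub>v y) = M *\<^sub>v map_vec Re y"
  proof (rule eq_vecI)
    fix i assume "i < dim_vec (M *\<^sub>v map_vec Re y)"
    then show "map_vec Re (map_mat complex_of_real M *\<^sub>v y) $ i = (M *\<^sub>v map_vec Re y) $ i"
      using assms by (simp add: scalar_prod_def)
  qed (use assms in simp)
  show "map_vec Im (map_mat complex_of_real M *\<^sub>v y) = M *\<^sub>v map_vec Im y"
  proof (rule eq_vecI)
    fix i assume "i < dim_vec (M *\<^sub>v map_vec Im y)"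
    then show "map_vec Im (map_mat complex_of_real M *\<^sub>v y) $ i = (M *\<^sub>v map_vec Im y) $ i"
      using assms by (simp add: scalar_prod_def)
  qed (use assms in simp)
qed

lemma map_vec_Re_Im_eq_zero:
  assumes "y \<in> carrier_vec k" "map_vec Re y = 0\<^sub>v k" "map_vec Im y = 0\<^sub>v k"
  shows "y = 0\<^sub>v k"
proof (rule eq_vecI)
  fix i assume i: "i < dim_vec (0\<^sub>v k :: complex vec)"
  then have "map_vec Re y $ i = 0" "map_vec Im y $ i = 0" unfolding assms(2,3) by auto
  with i assms(1) show "y $ i = 0\<^sub>v k $ i" by (simp add: complex_eq_iff)
qed (use assms(1) in simp)

section \<open>Products and spectra of block matrices\<close>

lemma block3_mat_mult_vec:
  fixes f :: "real \<Rightarrow> 'a :: comm_ring_1"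
  assumes M: "M11 \<in> carrier_mat n n" "M12 \<in> carrier_mat n m" "M13 \<in> carrier_mat n p"
    "M21 \<in> carrier_mat m n" "M22 \<in> carrier_mat m m" "M23 \<in> carrier_mat m p"
    "M31 \<in> carrier_mat p n" "M32 \<in> carrier_mat p m" "M33 \<in> carrier_mat p p"
    and v: "x \<in> carrier_vec n" "y \<in> carrier_vec m" "u \<in> carrier_vec p"
  shows "map_mat f (block3_mat M11 M12 M13 M21 M22 M23 M31 M32 M33) *\<^sub>v (x @\<^sub>v (y @\<^sub>v u)) =
    (map_mat f M11 *\<^sub>v x + (map_mat f M12 *\<^sub>v y + map_mat f M13 *\<^sub>v u)) @\<^sub>v
    ((map_mat f M21 *\<^sub>v x + (map_mat f M22 *\<^sub>v y + map_mat f M23 *\<^sub>v u)) @\<^sub>v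
     (map_mat f M31 *\<^sub>v x + (map_mat f M32 *\<^sub>v y + map_mat f M33 *\<^sub>v u)))"
proof -
  let ?f = "map_mat f"
  let ?T = "four_block_mat M12 M13 (0\<^sub>m 0 (dim_col M12)) (0\<^sub>m 0 (dim_col M13))"
  let ?D = "four_block_mat M22 M23 M32 M33"
  have T: "?T \<in> carrier_mat n (m + p)" using four_block_carrier_mat[OF M(2), of "0\<^sub>m 0 (dim_col M13)" 0 p] M by simp
  have D: "?D \<in> carrier_mat (m + p) (m + p)" using M by simp
  have S: "M21 @\<^sub>r M31 \<in> carrier_mat (m + p) n" using M by simp
  have fS: "?f (M21 @\<^sub>r M31) = ?f M21 @\<^sub>r ?f M31"
    unfolding append_rows_def using M
    by (subst map_four_block_mat[of _ m n _ 0 _ p]) auto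
  have fT: "?f ?T *\<^sub>v (y @\<^sub>v u) = ?f M12 *\<^sub>v y + ?f M13 *\<^sub>v u"
  proof -
    have "?f ?T *\<^sub>v (y @\<^sub>v u) = four_block_mat (?f M12) (?f M13) (?f (0\<^sub>m 0 m)) (?f (0\<^sub>m 0 p)) *\<^sub>v (y @\<^sub>v u)"
      using M by (subst map_four_block_mat[of _ n m _ p _ 0]) auto
    also have "\<dots> = (?f M12 *\<^sub>v y + ?f M13 *\<^sub>v u) @\<^sub>v (?f (0\<^sub>m 0 m) *\<^sub>v y + ?f (0\<^sub>m 0 p) *\<^sub>v u)"
      using M v by (intro four_block_mat_mult_vec[of _ n m _ p _ 0]) auto
    \<comment> \<open>The lower half comes from zero-row blocks and has dimension 0, so appending it
      changes nothing.\<close>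
    also have "\<dots> = ?f M12 *\<^sub>v y + ?f M13 *\<^sub>v u"
      using M v by (intro eq_vecI) auto
    finally show ?thesis .
  qed
  have fD: "?f ?D *\<^sub>v (y @\<^sub>v u) = (?f M22 *\<^sub>v y + ?f M23 *\<^sub>v u) @\<^sub>v (?f M32 *\<^sub>v y + ?f M33 *\<^sub>v u)"
    using M v by (subst map_four_block_mat[of _ m m _ p _ p])
      (auto intro!: four_block_mat_mult_vec[of _ m m _ p _ p])
  have "?f (block3_mat M11 M12 M13 M21 M22 M23 M31 M32 M33) =
    four_block_mat (?f M11) (?f ?T) (?f (M21 @\<^sub>r M31)) (?f ?D)"
    unfolding block3_mat_def by (rule map_four_block_mat[OF M(1) T S D])
  also have "\<dots> *\<^sub>v (x @\<^sub>v (y @\<^sub>v u)) = (?f M11 *\<^sub>v x + ?f ?T *\<^sub>v (y @\<^sub>v u)) @\<^sub>v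
    (?f (M21 @\<^sub>r M31) *\<^sub>v x + ?f ?D *\<^sub>v (y @\<^sub>v u))"
    using M T S D v by (intro four_block_mat_mult_vec[of _ n n _ "m + p" _ "m + p"]) auto
  also have "?f (M21 @\<^sub>r M31) *\<^sub>v x + ?f ?D *\<^sub>v (y @\<^sub>v u) =
    (?f M21 *\<^sub>v x + (?f M22 *\<^sub>v y + ?f M23 *\<^sub>v u)) @\<^sub>v (?f M31 *\<^sub>v x + (?f M32 *\<^sub>v y + ?f M33 *\<^sub>v u))"
    unfolding fS fD using M v
    by (subst mat_mult_append[of _ m n _ p]) (auto intro!: append_vec_add[of _ m _ _ p])
  finally show ?thesis unfolding fT .
qed

lemma block3_mat_carrier:
  assumes "M11 \<in> carrier_mat n n" "M12 \<in> carrier_mat n m" "M13 \<in> carrier_mat n p"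
    "M21 \<in> carrier_mat m n" "M22 \<in> carrier_mat m m" "M23 \<in> carrier_mat m p"
    "M31 \<in> carrier_mat p n" "M32 \<in> carrier_mat p m" "M33 \<in> carrier_mat p p"
  shows "block3_mat M11 M12 M13 M21 M22 M23 M31 M32 M33 \<in> carrier_mat (n + (m + p)) (n + (m + p))"
  unfolding block3_mat_def using assms by simp

text \<open>The characteristic polynomial of a block triangular matrix is the product over its
  diagonal blocks, and \<open>proots\<close> sends products of nonzero polynomials to multiset
  sums.\<close>

lemma eigvals_mset_block_upper_triangular:
  fixes X Y :: "real mat"
  assumes X: "X \<in> carrier_mat n k" and Y: "Y \<in> carrier_mat k k"
  shows "eigvals_mset (four_block_mat (c \<cdot>\<^sub>m 1\<^sub>m n) X (0\<^sub>m k n) Y) =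
    replicate_mset n (complex_of_real c) + eigvals_mset Y"
proof -
  let ?h = "map_mat complex_of_real"
  let ?I = "?h (c \<cdot>\<^sub>m 1\<^sub>m n)"
  have I: "?I \<in> carrier_mat n n" and hY: "?h Y \<in> carrier_mat k k" and hX: "?h X \<in> carrier_mat n k"
    using X Y by auto
  have "?h (four_block_mat (c \<cdot>\<^sub>m 1\<^sub>m n) X (0\<^sub>m k n) Y) = four_block_mat ?I (?h X) (0\<^sub>m k n) (?h Y)"
    using X Y by (subst map_four_block_mat[of _ n n _ k _ k]) (auto intro!: cong_four_block_mat)
  then have "char_poly (?h (four_block_mat (c \<cdot>\<^sub>m 1\<^sub>m n) X (0\<^sub>m k n) Y)) = char_poly ?I * char_poly (?h Y)"
    using char_poly_factorized[OF I] char_poly_factorized[OF hY]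
    by (intro char_poly_0_block[OF _ _ _ I hX hY]) blast+
  moreover have "char_poly ?I = [:- complex_of_real c, 1:] ^ n"
  proof -
    have "char_poly ?I = (\<Prod>a\<leftarrow>diag_mat ?I. [:- a, 1:])"
      by (rule char_poly_upper_triangular[OF I]) auto
    also have "diag_mat ?I = replicate n (complex_of_real c)"
      by (auto simp: diag_mat_def intro!: nth_equalityI)
    finally show ?thesis by simp
  qed
  moreover have "char_poly (?h Y) \<noteq> 0" using degree_monic_char_poly[OF hY] by auto
  ultimately show ?thesis
    by (simp add: eigvals_mset_def proots_mult proots_power repeat_mset_replicate_mset)
qed

lemma map_vec_Re_Im_smult:
  assumes "Im z = 0"
  shows "map_vec Re (z \<cdot>\<^sub>v v) = Re z \<cdot>\<^sub>v map_vec Re v" "map_vec Im (z \<cdot>\<^sub>v v) = Re z \<cdot>\<^sub>v map_vec Im v"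
  using assms by (intro eq_vecI; simp)+

lemma map_vec_Re_Im_diff:
  assumes "v \<in> carrier_vec k" "w \<in> carrier_vec k"
  shows "map_vec Re (v - w) = map_vec Re v - map_vec Re w" "map_vec Im (v - w) = map_vec Im v - map_vec Im w"
  using assms by (intro eq_vecI; simp)+

text \<open>These are the first and second block rows of the preconditioner and the second block row
  of the saddle point matrix, in the shape that block multiplication leaves behind.\<close>

lemma block_arith:
  fixes a b l :: "'a :: comm_ring_1 vec"
  assumes a: "a \<in> carrier_vec k" and b: "b \<in> carrier_vec k"
  shows "c \<cdot>\<^sub>v a + (c \<cdot>\<^sub>v b + 0\<^sub>v k) = c \<cdot>\<^sub>v (a + b)"
    and "l \<in> carrier_vec k \<Longrightarrow> - (c \<cdot>\<^sub>v a) + (l + - (c \<cdot>\<^sub>v b)) = l - c \<cdot>\<^sub>v (a + b)"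
    and "- a + (0\<^sub>v k + - b) = - (a + b)"
proof -
  show "c \<cdot>\<^sub>v a + (c \<cdot>\<^sub>v b + 0\<^sub>v k) = c \<cdot>\<^sub>v (a + b)" "- a + (0\<^sub>v k + - b) = - (a + b)"
    using a b by (intro eq_vecI; simp add: algebra_simps)+
  show "- (c \<cdot>\<^sub>v a) + (l + - (c \<cdot>\<^sub>v b)) = l - c \<cdot>\<^sub>v (a + b)" if "l \<in> carrier_vec k"
    using a b that by (intro eq_vecI; simp add: algebra_simps)
qed

lemma append_vec_smult: "c \<cdot>\<^sub>v (v @\<^sub>v w) = c \<cdot>\<^sub>v v @\<^sub>v c \<cdot>\<^sub>v w"
  by (intro eq_vecI) auto

lemma append_vec_split:
  assumes "v \<in> carrier_vec (k + l)"
  obtains a b where "a \<in> carrier_vec k" "b \<in> carrier_vec l" "v = a @\<^sub>v b"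
  using vec_first_last_append[OF assms] that by (metis vec_first_carrier vec_last_carrier)

lemma zero_append_vec: "0\<^sub>v k @\<^sub>v 0\<^sub>v l = 0\<^sub>v (k + l)"
  by (intro eq_vecI) auto

text \<open>For symmetric \<open>K\<close> this is the value of
  \<open>conjugate y \<bullet> (K y)\<close>, written with real and imaginary parts so that it is a
  real number and can be ordered.\<close>

definition hermitian_form :: "real mat \<Rightarrow> complex vec \<Rightarrow> real" where
  "hermitian_form K y = map_vec Re y \<bullet> (K *\<^sub>v map_vec Re y) + map_vec Im y \<bullet> (K *\<^sub>v map_vec Im y)"

lemma hermitian_form_pos:
  assumes K: "sym_pos_def k K" and y: "y \<in> carrier_vec k" "y \<noteq> 0\<^sub>v k"
  shows "hermitian_form K y > 0"
proof -
  have psd: "sym_psd k K" by (rule sym_pos_def_imp_psd[OF K])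
  have "map_vec Re y \<noteq> 0\<^sub>v k \<or> map_vec Im y \<noteq> 0\<^sub>v k" using map_vec_Re_Im_eq_zero[OF y(1)] y(2) by blast
  moreover have "map_vec Re y \<bullet> (K *\<^sub>v map_vec Re y) \<ge> 0" "map_vec Im y \<bullet> (K *\<^sub>v map_vec Im y) \<ge> 0"
    using psd y(1) by (auto simp: sym_psd_def)
  moreover have "v \<bullet> (K *\<^sub>v v) > 0" if "v \<in> carrier_vec k" "v \<noteq> 0\<^sub>v k" for v
    using K that by (simp add: sym_pos_def_def)
  ultimately show ?thesis unfolding hermitian_form_def
    using y(1) by (metis add_nonneg_pos add_pos_nonneg map_carrier_vec)
qed

lemma hermitian_form_smult:
  fixes K :: "real mat"
  assumes K: "K \<in> carrier_mat k k" "K\<^sup>T = K" and y: "y \<in> carrier_vec k"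
  shows "hermitian_form K (t \<cdot>\<^sub>v y) = (cmod t)\<^sup>2 * hermitian_form K y"
proof -
  let ?K = "map_mat complex_of_real K"
  have Kc: "?K \<in> carrier_mat k k" using K by simp
  have "complex_of_real (hermitian_form K (t \<cdot>\<^sub>v y)) = conjugate (t \<cdot>\<^sub>v y) \<bullet> (?K *\<^sub>v (t \<cdot>\<^sub>v y))"
    unfolding hermitian_form_def by (rule hermitian_form_real_mat[OF K, symmetric]) (use y in simp)
  also have "\<dots> = cnj t * t * (conjugate y \<bullet> (?K *\<^sub>v y))"
    using y Kc by (simp add: conjugate_smult_vec mult_mat_vec[OF Kc y])
  also have "\<dots> = complex_of_real ((cmod t)\<^sup>2 * hermitian_form K y)"
    unfolding hermitian_form_real_mat[OF K y] hermitian_form_def of_real_mult complex_norm_square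
    by (simp only: mult.commute[of t])
  finally show ?thesis by (simp only: of_real_eq_iff)
qed

lemma conjugate_bilinear_transpose:
  fixes M :: "real mat" and y u :: "complex vec"
  assumes M: "M \<in> carrier_mat r c" and y: "y \<in> carrier_vec c" and u: "u \<in> carrier_vec r"
  shows "conjugate y \<bullet> (map_mat complex_of_real M\<^sup>T *\<^sub>v u) =
    cnj (conjugate u \<bullet> (map_mat complex_of_real M *\<^sub>v y))"
proof -
  have "conjugate y \<bullet> (map_mat complex_of_real M\<^sup>T *\<^sub>v u)
    = (\<Sum>i<c. \<Sum>j<r. cnj (y $ i) * (complex_of_real (M $$ (j,i)) * u $ j))"
    using M y u by (simp add: scalar_prod_def lessThan_atLeast0 sum_distrib_left)
  also have "\<dots> = (\<Sum>j<r. \<Sum>i<c. cnj (y $ i) * (complex_of_real (M $$ (j,i)) * u $ j))"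
    by (rule sum.swap)
  also have "\<dots> = cnj (\<Sum>j<r. \<Sum>i<c. cnj (u $ j) * (complex_of_real (M $$ (j,i)) * y $ i))"
    unfolding cnj_sum by (intro sum.cong refl) simp
  also have "(\<Sum>j<r. \<Sum>i<c. cnj (u $ j) * (complex_of_real (M $$ (j,i)) * y $ i))
    = conjugate u \<bullet> (map_mat complex_of_real M *\<^sub>v y)"
    using M y u by (simp add: scalar_prod_def lessThan_atLeast0 sum_distrib_left)
  finally show ?thesis .
qed

text \<open>With \<open>w = s + t\<close> one has \<open>z = 1 / w\<close> and
  \<open>z - 1 / s = - t / (s w)\<close>, so all four bounds are comparisons of
  \<open>cmod w\<close> with a constant or with \<open>cmod t\<close>.\<close>

lemma nonreal_eigenvalue_estimates:
  fixes z t :: complex and s \<theta> T :: real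
  assumes zt: "z * (complex_of_real s + t) = 1" and pos: "s > 0" "\<theta> > 0" "T > 0"
    and lo: "\<theta> * (cmod t)\<^sup>2 \<le> 2 * Re t" and hi: "1 \<le> T * (cmod t)\<^sup>2"
  shows "\<theta> / (2 + s * \<theta>) \<le> cmod z"
    and "cmod z \<le> sqrt (T / (1 + s * \<theta> + s\<^sup>2 * T))"
    and "1 / (s * (1 + s * sqrt T)) \<le> cmod (z - complex_of_real (1 / s))"
    and "cmod (z - complex_of_real (1 / s)) \<le> 2 / (s * (2 + s * \<theta>))"
proof -
  define w where "w = complex_of_real s + t"
  have t0: "t \<noteq> 0" using hi by auto
  have w0: "w \<noteq> 0" using zt unfolding w_def by auto
  have zw: "z = 1 / w" using zt w0 unfolding w_def[symmetric] by (simp add: field_simps)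
  have ct: "cmod t > 0" using t0 by simp
  have cz: "cmod z = 1 / cmod w" unfolding zw by (simp add: norm_divide)
  have cw: "cmod w > 0" using w0 by simp
  \<comment> \<open>Since \<open>Re t \<le> cmod t\<close>, one factor \<open>cmod t\<close>
    cancels, and \<open>\<theta> * cmod t \<le> 2\<close> remains.\<close>
  have "\<theta> * (cmod t)\<^sup>2 \<le> 2 * cmod t" using lo complex_Re_le_cmod[of t] by linarith
  then have t_le: "\<theta> * cmod t \<le> 2" using ct by (simp add: power2_eq_square)
  have "cmod w \<le> s + cmod t" unfolding w_def using norm_triangle_ineq[of "complex_of_real s" t] pos by simp
  then have "\<theta> * cmod w \<le> \<theta> * (s + cmod t)" using pos by simp
  also have "\<dots> \<le> 2 + s * \<theta>" using t_le by (simp add: algebra_simps)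
  finally show "\<theta> / (2 + s * \<theta>) \<le> cmod z" unfolding cz using cw pos by (simp add: field_simps add_pos_pos)
  have w2: "(cmod w)\<^sup>2 = s\<^sup>2 + 2 * s * Re t + (cmod t)\<^sup>2"
    unfolding w_def cmod_power2 by (simp add: power2_eq_square algebra_simps)
  have sre: "s * (\<theta> * (cmod t)\<^sup>2) \<le> s * (2 * Re t)" using lo pos by simp
  \<comment> \<open>Expanding the square of \<open>cmod w\<close> and bounding
    \<open>2 s Re t\<close> below through \<open>lo\<close> leaves a multiple of
    \<open>T * (cmod t)\<^sup>2\<close>, which is at least 1 by \<open>hi\<close>.\<close>
  have "1 + s * \<theta> + s\<^sup>2 * T \<le> (1 + s * \<theta>) * (T * (cmod t)\<^sup>2) + s\<^sup>2 * T"
    using mult_left_mono[OF hi, of "1 + s * \<theta>"] pos by simp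
  also have "\<dots> \<le> T * (cmod w)\<^sup>2"
    using mult_left_mono[OF sre, of T] pos(3) unfolding w2 by (simp add: algebra_simps)
  finally have *: "1 + s * \<theta> + s\<^sup>2 * T \<le> T * (cmod w)\<^sup>2" .
  have d: "1 + s * \<theta> + s\<^sup>2 * T > 0" using pos by (simp add: add_pos_pos)
  show "cmod z \<le> sqrt (T / (1 + s * \<theta> + s\<^sup>2 * T))"
  proof (rule real_le_rsqrt)
    show "(cmod z)\<^sup>2 \<le> T / (1 + s * \<theta> + s\<^sup>2 * T)"
      unfolding cz using * d cw pos by (simp add: power_divide field_simps)
  qed
  have "z - complex_of_real (1 / s) = - (t / (of_real s * w))"
    unfolding zw using w0 pos by (simp add: w_def field_simps)
  then have dist: "cmod (z - complex_of_real (1 / s)) = cmod t / (s * cmod w)"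
    using pos by (simp add: norm_divide norm_mult)
  have "1 \<le> sqrt (T * (cmod t)\<^sup>2)" using hi by simp
  then have "1 \<le> sqrt T * cmod t" by (simp add: real_sqrt_mult)
  then have "s * 1 \<le> s * (sqrt T * cmod t)" using pos by simp
  with \<open>cmod w \<le> s + cmod t\<close> have "cmod w \<le> cmod t * (1 + s * sqrt T)" by (simp add: algebra_simps)
  moreover have "1 + s * sqrt T > 0" using pos by (simp add: add_pos_pos)
  moreover have "1 / (s * d) \<le> cmod t / (s * cmod w)" if "cmod w \<le> cmod t * d" "d > 0" for d
    using that cw pos by (simp add: field_simps)
  ultimately show "1 / (s * (1 + s * sqrt T)) \<le> cmod (z - complex_of_real (1 / s))"
    unfolding dist by blast
  \<comment> \<open>The triangle inequality bounds \<open>cmod w\<close> on the wrong side here, so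
    squares are compared: the left expands into three terms, the cross term is controlled by
    \<open>lo\<close> and the last one by \<open>\<theta> * cmod t \<le> 2\<close>.\<close>
  have "(cmod t * (2 + s * \<theta>))\<^sup>2 \<le> (2 * cmod w)\<^sup>2"
  proof -
    have "(s * (\<theta> * cmod t))\<^sup>2 \<le> (s * 2)\<^sup>2" using t_le pos ct by (intro power_mono mult_left_mono) auto
    with sre show ?thesis unfolding power_mult_distrib w2
      by (simp add: power2_eq_square algebra_simps)
  qed
  then have "cmod t * (2 + s * \<theta>) \<le> 2 * cmod w" by (rule power2_le_imp_le) simp
  then have "cmod t * (2 + s * \<theta>) * s \<le> 2 * cmod w * s" using pos by simp
  then show "cmod (z - complex_of_real (1 / s)) \<le> 2 / (s * (2 + s * \<theta>))"
    unfolding dist using cw pos by (simp add: field_simps add_pos_pos)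
qed

section \<open>The reduced eigenvalue problem\<close>

locale lpess =
  fixes n m p :: nat and s :: real and A B C L2 L3 :: "real mat"
  assumes dims: "n > 0" "m > 0" "p > 0"
    and A: "sym_pos_def n A" and L2: "sym_pos_def m L2" and L3: "sym_pos_def p L3"
    and B: "full_row_rank m n B" and C: "full_row_rank p m C"
    and s: "s > 0"
begin

text \<open>\<open>Q\<close> arises when the first block component is eliminated. In the notation of
  the theorem, \<open>qmin\<close> and \<open>qmax\<close> are the extremes for \<open>Q\<close>,
  and \<open>gmin\<close> and \<open>gmax\<close>, built from \<open>G\<close>, are those with a
  tilde.\<close>

definition "Q = B * mat_inv A * B\<^sup>T"
definition "G = C * mat_inv L2 * C\<^sup>T"
definition "qmin = lambda_min (mat_inv L2 * Q)"
definition "qmax = lambda_max (mat_inv L2 * Q)"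
definition "gmin = lambda_min (mat_inv L3 * G)"
definition "gmax = lambda_max (mat_inv L3 * G)"

lemma carriers [simp]:
  "A \<in> carrier_mat n n" "L2 \<in> carrier_mat m m" "L3 \<in> carrier_mat p p"
  "B \<in> carrier_mat m n" "C \<in> carrier_mat p m"
  using A L2 L3 B C by (auto simp: sym_pos_def_def full_row_rank_def)

lemma Q: "sym_pos_def m Q"
  unfolding Q_def by (rule sym_pos_def_congruence[OF sym_pos_def_mat_inv[OF A] B])

lemma G: "sym_pos_def p G"
  unfolding G_def by (rule sym_pos_def_congruence[OF sym_pos_def_mat_inv[OF L2] C])

lemma carriers_Q_G [simp]: "Q \<in> carrier_mat m m" "G \<in> carrier_mat p p"
  using Q G by (auto simp: sym_pos_def_def)

lemma symmetric: "Q\<^sup>T = Q" "G\<^sup>T = G" "L2\<^sup>T = L2" "L3\<^sup>T = L3"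
  using Q G L2 L3 by (auto simp: sym_pos_def_def)

lemma form_nonneg:
  "v \<in> carrier_vec m \<Longrightarrow> v \<bullet> (Q *\<^sub>v v) \<ge> 0" "v \<in> carrier_vec m \<Longrightarrow> v \<bullet> (L2 *\<^sub>v v) \<ge> 0"
  "u \<in> carrier_vec p \<Longrightarrow> u \<bullet> (L3 *\<^sub>v u) \<ge> 0"
  using Q L2 L3 by (auto dest!: sym_pos_def_imp_psd simp: sym_psd_def)

lemma form_pos:
  "v \<in> carrier_vec m \<Longrightarrow> v \<noteq> 0\<^sub>v m \<Longrightarrow> v \<bullet> (Q *\<^sub>v v) > 0"
  "v \<in> carrier_vec m \<Longrightarrow> v \<noteq> 0\<^sub>v m \<Longrightarrow> v \<bullet> (L2 *\<^sub>v v) > 0"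
  "u \<in> carrier_vec p \<Longrightarrow> u \<noteq> 0\<^sub>v p \<Longrightarrow> u \<bullet> (L3 *\<^sub>v u) > 0"
  using Q L2 L3 by (auto simp: sym_pos_def_def)

lemma form_bounds:
  assumes "y \<in> carrier_vec m"
  shows "qmin * (y \<bullet> (L2 *\<^sub>v y)) \<le> y \<bullet> (Q *\<^sub>v y)" "y \<bullet> (Q *\<^sub>v y) \<le> qmax * (y \<bullet> (L2 *\<^sub>v y))"
  unfolding qmin_def qmax_def
  using lambda_min_le_form[OF L2 carriers_Q_G(1) symmetric(1) assms]
    form_le_lambda_max[OF L2 carriers_Q_G(1) symmetric(1) assms] .

lemma G_form_bounds:
  assumes "u \<in> carrier_vec p"
  shows "gmin * (u \<bullet> (L3 *\<^sub>v u)) \<le> u \<bullet> (G *\<^sub>v u)" "u \<bullet> (G *\<^sub>v u) \<le> gmax * (u \<bullet> (L3 *\<^sub>v u))"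
  unfolding gmin_def gmax_def
  using lambda_min_le_form[OF L3 carriers_Q_G(2) symmetric(2) assms]
    form_le_lambda_max[OF L3 carriers_Q_G(2) symmetric(2) assms] .

lemma extremes_pos: "qmin > 0" "gmin > 0" "qmax > 0" "gmax > 0"
proof -
  show q: "qmin > 0" unfolding qmin_def by (rule lambda_min_pos[OF L2 Q dims(2)])
  show g: "gmin > 0" unfolding gmin_def by (rule lambda_min_pos[OF L3 G dims(3)])
  \<comment> \<open>Evaluating both form bounds at one nonzero vector shows that each maximum is at
    least the positive minimum.\<close>
  let ?y = "unit_vec m 0 :: real vec" and ?u = "unit_vec p 0 :: real vec"
  have y: "?y \<in> carrier_vec m" "?y \<noteq> 0\<^sub>v m" and u: "?u \<in> carrier_vec p" "?u \<noteq> 0\<^sub>v p"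
    using dims by auto
  have "qmin * (?y \<bullet> (L2 *\<^sub>v ?y)) \<le> qmax * (?y \<bullet> (L2 *\<^sub>v ?y))"
    using form_bounds[OF y(1)] by linarith
  then show "qmax > 0" using form_pos(2)[OF y] q by simp
  have "gmin * (?u \<bullet> (L3 *\<^sub>v ?u)) \<le> gmax * (?u \<bullet> (L3 *\<^sub>v ?u))"
    using G_form_bounds[OF u(1)] by linarith
  then show "gmax > 0" using form_pos(3)[OF u] g by simp
qed

text \<open>The vector \<open>w = L2\<^sup>-\<^sup>1 C\<^sup>T u\<close> represents
  \<open>y \<mapsto> u \<bullet> (C y)\<close> in the inner product of \<open>L2\<close>. Its
  squared norm there is the form of \<open>G\<close>, which is how \<open>gmin\<close> and
  \<open>gmax\<close> enter.\<close>

lemma preconditioned_adjoint: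
  assumes u: "u \<in> carrier_vec p"
  obtains w where "w \<in> carrier_vec m" "L2 *\<^sub>v w = C\<^sup>T *\<^sub>v u" "w \<bullet> (L2 *\<^sub>v w) = u \<bullet> (G *\<^sub>v u)"
proof
  note inj = sym_pos_def_injective[OF L2]
  note I = mat_inv_injective[OF carriers(2) inj]
  let ?w = "mat_inv L2 *\<^sub>v (C\<^sup>T *\<^sub>v u)"
  have v: "C\<^sup>T *\<^sub>v u \<in> carrier_vec m"
    using u by (intro mult_mat_vec_carrier[of _ m p]) auto
  show w: "?w \<in> carrier_vec m" by (rule mult_mat_vec_carrier[OF I(1) v])
  show Lw: "L2 *\<^sub>v ?w = C\<^sup>T *\<^sub>v u" by (rule mat_inv_cancel(1)[OF carriers(2) inj v])
  have CI: "C * mat_inv L2 \<in> carrier_mat p m" by (rule mult_carrier_mat[OF carriers(5) I(1)])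
  have "G *\<^sub>v u = C *\<^sub>v ?w"
    unfolding G_def using assoc_mult_mat_vec[OF CI _ u, of "C\<^sup>T"] assoc_mult_mat_vec[OF carriers(5) I(1) v] by simp
  then show "?w \<bullet> (L2 *\<^sub>v ?w) = u \<bullet> (G *\<^sub>v u)"
    unfolding Lw using bilinear_transpose[OF carriers(5) u w] by simp
qed

text \<open>An inequality of Young type: expand the nonnegative form of \<open>L2\<close> at
  \<open>gmax y - w\<close>, bound the form of \<open>G\<close> by \<open>gmax\<close> times that of
  \<open>L3\<close>, and cancel the positive factor \<open>gmax\<close>.\<close>

lemma coupling_le:
  assumes y: "y \<in> carrier_vec m" and u: "u \<in> carrier_vec p"
  shows "2 * (u \<bullet> (C *\<^sub>v y)) \<le> u \<bullet> (L3 *\<^sub>v u) + gmax * (y \<bullet> (L2 *\<^sub>v y))"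
proof -
  obtain w where w: "w \<in> carrier_vec m" "L2 *\<^sub>v w = C\<^sup>T *\<^sub>v u" "w \<bullet> (L2 *\<^sub>v w) = u \<bullet> (G *\<^sub>v u)"
    using preconditioned_adjoint[OF u] .
  have "y \<bullet> (L2 *\<^sub>v w) = u \<bullet> (C *\<^sub>v y)"
    unfolding w(2) using bilinear_transpose[OF carriers(5) u y] by simp
  moreover have "(gmax \<cdot>\<^sub>v y - 1 \<cdot>\<^sub>v w) \<bullet> (L2 *\<^sub>v (gmax \<cdot>\<^sub>v y - 1 \<cdot>\<^sub>v w)) \<ge> 0"
    using y w by (intro form_nonneg) auto
  ultimately have "0 \<le> gmax\<^sup>2 * (y \<bullet> (L2 *\<^sub>v y)) - 2 * gmax * (u \<bullet> (C *\<^sub>v y)) + u \<bullet> (G *\<^sub>v u)"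
    unfolding quadratic_form_diff[OF carriers(2) symmetric(3) y w(1)] w(3) by simp
  also have "\<dots> \<le> gmax\<^sup>2 * (y \<bullet> (L2 *\<^sub>v y)) - 2 * gmax * (u \<bullet> (C *\<^sub>v y)) + gmax * (u \<bullet> (L3 *\<^sub>v u))"
    using G_form_bounds(2)[OF u] by simp
  also have "\<dots> = gmax * (gmax * (y \<bullet> (L2 *\<^sub>v y)) - 2 * (u \<bullet> (C *\<^sub>v y)) + u \<bullet> (L3 *\<^sub>v u))"
    by (simp add: power2_eq_square algebra_simps)
  finally show ?thesis using extremes_pos(4) by (simp add: zero_le_mult_iff)
qed

text \<open>Excludes the eigenvalue 0, for which the reduced equations become these two. Then
  \<open>y \<bullet> (Q y) = u \<bullet> (C y) = 0\<close> forces \<open>y = 0\<close>, and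
  injectivity of \<open>C\<^sup>T\<close> forces \<open>u = 0\<close>.\<close>

lemma kernel_trivial:
  assumes y: "y \<in> carrier_vec m" and u: "u \<in> carrier_vec p"
    and "Q *\<^sub>v y = C\<^sup>T *\<^sub>v u" "C *\<^sub>v y = 0\<^sub>v p"
  shows "y = 0\<^sub>v m \<and> u = 0\<^sub>v p"
proof -
  have "y \<bullet> (Q *\<^sub>v y) = u \<bullet> (C *\<^sub>v y)"
    unfolding assms(3) using bilinear_transpose[OF carriers(5) u y] by simp
  also have "\<dots> = 0" using assms(4) u by simp
  finally have y0: "y = 0\<^sub>v m" using form_pos(1)[OF y] by fastforce
  then have "C\<^sup>T *\<^sub>v u = 0\<^sub>v m" using assms(3) mult_mat_zero_vec[OF carriers_Q_G(1)] by simp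
  with full_row_rank_transpose_injective[OF C u] y0 show ?thesis by blast
qed

text \<open>Here \<open>t = 1 / \<lambda> - s\<close>. Pairing the equations with \<open>y\<close>
  and \<open>u\<close> gives \<open>t q = a + b\<close>, hence the first two claims. If both
  alternatives of the third failed, the form of \<open>t Q - L2\<close> would force
  \<open>b \<le> 0\<close>, so \<open>t q \<le> a\<close>, against
  \<open>1 < t * qmin\<close>.\<close>

lemma reduced_real_ratio:
  assumes y: "y \<in> carrier_vec m" and u: "u \<in> carrier_vec p" and ne: "y \<noteq> 0\<^sub>v m \<or> u \<noteq> 0\<^sub>v p"
    and eq1: "L2 *\<^sub>v y = t \<cdot>\<^sub>v (Q *\<^sub>v y - C\<^sup>T *\<^sub>v u)" and eq2: "L3 *\<^sub>v u = t \<cdot>\<^sub>v (C *\<^sub>v y)"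
  shows "t > 0" "1 \<le> t * qmax" "t * qmin \<le> 1 \<or> t * gmin \<le> qmax"
proof -
  define a where "a = y \<bullet> (L2 *\<^sub>v y)"
  define b where "b = u \<bullet> (L3 *\<^sub>v u)"
  define q where "q = y \<bullet> (Q *\<^sub>v y)"
  define g where "g = u \<bullet> (C *\<^sub>v y)"
  have Qy: "Q *\<^sub>v y \<in> carrier_vec m" and Cy: "C *\<^sub>v y \<in> carrier_vec p"
    using y by (auto intro: mult_mat_vec_carrier[OF carriers_Q_G(1)] mult_mat_vec_carrier[OF carriers(5)])
  have Cu: "C\<^sup>T *\<^sub>v u \<in> carrier_vec m" using u by (intro mult_mat_vec_carrier[of _ m p]) auto
  have yCu: "y \<bullet> (C\<^sup>T *\<^sub>v u) = g" unfolding g_def using bilinear_transpose[OF carriers(5) u y] by simp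
  have L2_form: "v \<bullet> (L2 *\<^sub>v y) = t * (v \<bullet> (Q *\<^sub>v y) - v \<bullet> (C\<^sup>T *\<^sub>v u))" if "v \<in> carrier_vec m" for v
    unfolding eq1 using that Qy Cu by (simp add: scalar_prod_minus_distrib[of _ m])
  have a: "a = t * (q - g)" using L2_form[OF y] yCu by (simp add: a_def q_def)
  have b: "b = t * g" unfolding b_def g_def eq2 using u Cy by simp
  have "y \<noteq> 0\<^sub>v m"
  proof
    assume y0: "y = 0\<^sub>v m"
    then have "b = 0" using b u mult_mat_zero_vec[OF carriers(5)] by (simp add: g_def)
    then show False using y0 ne form_pos(3)[OF u] by (auto simp: b_def)
  qed
  then have a0: "a > 0" and q0: "q > 0" unfolding a_def q_def using form_pos(1,2)[OF y] by auto
  have b0: "b \<ge> 0" unfolding b_def by (rule form_nonneg(3)[OF u])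
  have tq: "t * q = a + b" using a b by (simp add: algebra_simps)
  then show t0: "t > 0" using a0 b0 q0 by (metis add_pos_nonneg zero_less_mult_pos2)
  have "a \<le> t * q" using tq b0 by simp
  also have "t * q \<le> t * (qmax * a)"
    using form_bounds(2)[OF y] t0 by (simp add: a_def q_def)
  finally show "1 \<le> t * qmax" using a0 by (simp add: mult.assoc[symmetric])
  show "t * qmin \<le> 1 \<or> t * gmin \<le> qmax"
  proof (rule ccontr)
    assume "\<not> ?thesis"
    then have t1: "1 < t * qmin" and t2: "qmax < t * gmin" by auto
    \<comment> \<open>\<open>K = t Q - L2\<close> is positive semidefinite; evaluate its form at \<open>w - qmax y\<close>.\<close>
    obtain w where w: "w \<in> carrier_vec m" "L2 *\<^sub>v w = C\<^sup>T *\<^sub>v u" "w \<bullet> (L2 *\<^sub>v w) = u \<bullet> (G *\<^sub>v u)"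
      using preconditioned_adjoint[OF u] .
    define X where "X = w \<bullet> (L2 *\<^sub>v w)"
    define K where "K = t \<cdot>\<^sub>m Q - L2"
    have K: "K \<in> carrier_mat m m" "K\<^sup>T = K"
      unfolding K_def using transpose_minus[of "t \<cdot>\<^sub>m Q" m m L2] symmetric
      by (auto simp: transpose_smult_mat intro: minus_carrier_mat)
    have K_form: "v \<bullet> (K *\<^sub>v v') = t * (v \<bullet> (Q *\<^sub>v v')) - v \<bullet> (L2 *\<^sub>v v')"
      if v: "v \<in> carrier_vec m" "v' \<in> carrier_vec m" for v v'
    proof -
      have "K *\<^sub>v v' = t \<cdot>\<^sub>v (Q *\<^sub>v v') - L2 *\<^sub>v v'" unfolding K_def using v
        by (simp add: minus_mult_distrib_mat_vec[of _ m m] smult_mat_mult_vec[of _ m m])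
      moreover have "Q *\<^sub>v v' \<in> carrier_vec m" "L2 *\<^sub>v v' \<in> carrier_vec m"
        using v by (auto intro: mult_mat_vec_carrier[OF carriers_Q_G(1)] mult_mat_vec_carrier[OF carriers(2)])
      ultimately show ?thesis using v by (simp add: scalar_prod_minus_distrib[of _ m])
    qed
    have K_nonneg: "v \<bullet> (K *\<^sub>v v) \<ge> 0" if v: "v \<in> carrier_vec m" for v
    proof -
      have "v \<bullet> (L2 *\<^sub>v v) \<le> t * qmin * (v \<bullet> (L2 *\<^sub>v v))"
        using mult_right_mono[of 1 "t * qmin", OF _ form_nonneg(2)[OF v]] t1 by simp
      also have "\<dots> \<le> t * (v \<bullet> (Q *\<^sub>v v))"
        using mult_left_mono[OF form_bounds(1)[OF v], of t] t0 by (simp add: mult.assoc)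
      finally show ?thesis using K_form[OF v v] by simp
    qed
    have wKw: "w \<bullet> (K *\<^sub>v w) \<le> (t * qmax - 1) * X"
      using mult_left_mono[OF form_bounds(2)[OF w(1)], of t] t0 unfolding K_form[OF w(1) w(1)] X_def
      by (simp add: algebra_simps)
    \<comment> \<open>The first reduced equation says
      \<open>K y = t C\<^sup>T u = t L2 w\<close>.\<close>
    have wKy: "w \<bullet> (K *\<^sub>v y) = t * X"
      unfolding K_form[OF w(1) y] L2_form[OF w(1)] X_def w(2) by (simp add: algebra_simps)
    have yKy: "y \<bullet> (K *\<^sub>v y) = b"
      unfolding K_form[OF y y] using tq by (simp add: a_def q_def)
    have "0 \<le> (1 \<cdot>\<^sub>v w - qmax \<cdot>\<^sub>v y) \<bullet> (K *\<^sub>v (1 \<cdot>\<^sub>v w - qmax \<cdot>\<^sub>v y))"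
      using w(1) y by (intro K_nonneg) auto
    also have "\<dots> = w \<bullet> (K *\<^sub>v w) - 2 * qmax * (t * X) + qmax\<^sup>2 * b"
      unfolding quadratic_form_diff[OF K w(1) y] wKy yKy by simp
    \<comment> \<open>The coefficient of \<open>X\<close> is
      \<open>(t qmax - 1) - 2 t qmax = - (t qmax + 1)\<close>.\<close>
    also have "\<dots> \<le> qmax\<^sup>2 * b - (qmax * t + 1) * X"
      using wKw by (simp add: algebra_simps)
    finally have "(qmax * t + 1) * X \<le> qmax\<^sup>2 * b" by simp
    moreover have "(qmax * t + 1) * (gmin * b) \<le> (qmax * t + 1) * X"
      using G_form_bounds(1)[OF u] extremes_pos t0 by (intro mult_left_mono) (auto simp: X_def w(3) b_def)
    ultimately have "((qmax * t + 1) * gmin - qmax\<^sup>2) * b \<le> 0" by (simp add: algebra_simps)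
    \<comment> \<open>Here the failure of the second alternative, \<open>qmax < t * gmin\<close>, is
      used.\<close>
    moreover have "(qmax * t + 1) * gmin - qmax\<^sup>2 > 0"
    proof -
      have "qmax * qmax < qmax * (t * gmin)" using t2 extremes_pos by simp
      with extremes_pos(2) show ?thesis by (simp add: power2_eq_square algebra_simps)
    qed
    ultimately have "b \<le> 0" by (simp add: mult_le_0_iff)
    then have "t * q \<le> a" using tq by simp
    moreover have "t * (qmin * a) \<le> t * q"
      using form_bounds(1)[OF y] t0 by (simp add: a_def q_def)
    ultimately have "(t * qmin) * a \<le> 1 * a" by (simp add: mult.assoc)
    with t1 a0 show False by (simp only: mult_le_cancel_right_pos)
  qed
qed

text \<open>The equations are cleared of denominators because \<open>r \<noteq> 0\<close> is only
  shown inside. Afterwards \<open>r = 1 / (s + t)\<close> is decreasing in \<open>t\<close>, and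
  each bound on \<open>t\<close> becomes one end of the interval.\<close>

lemma real_eigenvalue_interval:
  assumes y: "y \<in> carrier_vec m" and u: "u \<in> carrier_vec p" and ne: "y \<noteq> 0\<^sub>v m \<or> u \<noteq> 0\<^sub>v p"
    and eq1: "r \<cdot>\<^sub>v (L2 *\<^sub>v y) = (1 - s * r) \<cdot>\<^sub>v (Q *\<^sub>v y - C\<^sup>T *\<^sub>v u)"
    and eq2: "r \<cdot>\<^sub>v (L3 *\<^sub>v u) = (1 - s * r) \<cdot>\<^sub>v (C *\<^sub>v y)"
  shows "r \<in> {min (qmin / (1 + s * qmin)) (gmin / (qmax + s * gmin)) .. qmax / (1 + s * qmax)}"
proof -
  have c: "Q *\<^sub>v y \<in> carrier_vec m" "C *\<^sub>v y \<in> carrier_vec p" "L2 *\<^sub>v y \<in> carrier_vec m" "L3 *\<^sub>v u \<in> carrier_vec p"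
    using y u by (auto intro: mult_mat_vec_carrier[OF carriers_Q_G(1)] mult_mat_vec_carrier[OF carriers(5)]
        mult_mat_vec_carrier[OF carriers(2)] mult_mat_vec_carrier[OF carriers(3)])
  have Cu: "C\<^sup>T *\<^sub>v u \<in> carrier_vec m" using u by (intro mult_mat_vec_carrier[of _ m p]) auto
  have r0: "r \<noteq> 0"
  proof
    assume r: "r = 0"
    have zero: "0 \<cdot>\<^sub>v v = 0\<^sub>v k" if "v \<in> carrier_vec k" for v :: "real vec" and k
      using that by (intro eq_vecI) auto
    have "Q *\<^sub>v y - C\<^sup>T *\<^sub>v u = 0\<^sub>v m" using eq1 zero[OF c(3)] by (simp add: r)
    moreover have "v = (v - w) + w" if "v \<in> carrier_vec m" "w \<in> carrier_vec m" for v w :: "real vec"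
      using that by (intro eq_vecI) auto
    note this[OF c(1) Cu]
    ultimately have "Q *\<^sub>v y = C\<^sup>T *\<^sub>v u" using Cu by simp
    moreover have "C *\<^sub>v y = 0\<^sub>v p" using eq2 zero[OF c(4)] by (simp add: r)
    ultimately show False using kernel_trivial[OF y u] ne by blast
  qed
  define t where "t = (1 - s * r) / r"
  note t = reduced_real_ratio[OF y u ne
    smult_eq_smult_imp[OF eq1 r0, folded t_def] smult_eq_smult_imp[OF eq2 r0, folded t_def]]
  have "r * (s + t) = 1" using r0 by (simp add: t_def field_simps)
  moreover have st: "s + t > 0" using s t(1) by simp
  ultimately have r: "r = 1 / (s + t)" by (simp add: field_simps)
  have "r \<le> qmax / (1 + s * qmax)"
    unfolding r using st s t(2) extremes_pos by (simp add: field_simps add_pos_pos)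
  \<comment> \<open>The alternatives \<open>t \<le> 1 / qmin\<close> and
    \<open>t \<le> qmax / gmin\<close> correspond to the two entries of the minimum.\<close>
  moreover have "qmin / (1 + s * qmin) \<le> r \<or> gmin / (qmax + s * gmin) \<le> r"
    using t(3) st s extremes_pos unfolding r by (auto simp: field_simps add_pos_pos)
  ultimately show ?thesis by auto
qed

section \<open>Real and non-real eigenvalues of the reduced complex problem\<close>

abbreviation "cmat \<equiv> map_mat complex_of_real"

context
  fixes z :: complex and y u :: "complex vec"
  assumes y: "y \<in> carrier_vec m" and u: "u \<in> carrier_vec p" and ne: "y \<noteq> 0\<^sub>v m \<or> u \<noteq> 0\<^sub>v p"
    and eq1: "z \<cdot>\<^sub>v (cmat L2 *\<^sub>v y) = (1 - complex_of_real s * z) \<cdot>\<^sub>v (cmat Q *\<^sub>v y - cmat C\<^sup>T *\<^sub>v u)"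
    and eq2: "z \<cdot>\<^sub>v (cmat L3 *\<^sub>v u) = (1 - complex_of_real s * z) \<cdot>\<^sub>v (cmat C *\<^sub>v y)"
begin

lemma complex_carriers:
  "cmat Q *\<^sub>v y \<in> carrier_vec m" "cmat C *\<^sub>v y \<in> carrier_vec p" "cmat L2 *\<^sub>v y \<in> carrier_vec m"
  "cmat L3 *\<^sub>v u \<in> carrier_vec p" "cmat C\<^sup>T *\<^sub>v u \<in> carrier_vec m"
  using y u mult_mat_vec_carrier[of "cmat Q" m m] mult_mat_vec_carrier[of "cmat C" p m]
    mult_mat_vec_carrier[of "cmat L2" m m] mult_mat_vec_carrier[of "cmat L3" p p]
    mult_mat_vec_carrier[of "cmat C\<^sup>T" m p]
  by auto

text \<open>With real \<open>z\<close> all coefficients are real, so the real parts and the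
  imaginary parts of \<open>(y, u)\<close> solve the reduced system separately, and one of these two
  pairs is nonzero.\<close>

lemma real_eigenvalue_bounds:
  assumes "Im z = 0"
  shows "Re z \<in> {min (qmin / (1 + s * qmin)) (gmin / (qmax + s * gmin)) .. qmax / (1 + s * qmax)}"
proof -
  have mu: "Im (1 - complex_of_real s * z) = 0" "Re (1 - complex_of_real s * z) = 1 - s * Re z"
    using assms by auto
  have Ct: "C\<^sup>T \<in> carrier_mat m p" by simp
  note rules = map_vec_Re_Im_smult[OF assms] map_vec_Re_Im_smult[OF mu(1)] mu(2)
    map_vec_Re_Im_diff[OF complex_carriers(1,5)]
    map_vec_Re_Im_mult[OF carriers_Q_G(1) y] map_vec_Re_Im_mult[OF carriers(2) y]
    map_vec_Re_Im_mult[OF carriers(3) u] map_vec_Re_Im_mult[OF carriers(5) y] map_vec_Re_Im_mult[OF Ct u]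
  have "map_vec Re y \<noteq> 0\<^sub>v m \<or> map_vec Re u \<noteq> 0\<^sub>v p \<or> map_vec Im y \<noteq> 0\<^sub>v m \<or> map_vec Im u \<noteq> 0\<^sub>v p"
    using ne map_vec_Re_Im_eq_zero[OF y] map_vec_Re_Im_eq_zero[OF u] by blast
  moreover have "map_vec Re y \<in> carrier_vec m" "map_vec Im y \<in> carrier_vec m"
    "map_vec Re u \<in> carrier_vec p" "map_vec Im u \<in> carrier_vec p" using y u by auto
  ultimately show ?thesis
    using real_eigenvalue_interval[of "map_vec Re y" "map_vec Re u" "Re z"]
      real_eigenvalue_interval[of "map_vec Im y" "map_vec Im u" "Re z"]
      arg_cong[OF eq1, of "map_vec Re", unfolded rules] arg_cong[OF eq2, of "map_vec Re", unfolded rules]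
      arg_cong[OF eq1, of "map_vec Im", unfolded rules] arg_cong[OF eq2, of "map_vec Im", unfolded rules]
    by blast
qed

text \<open>Non-reality of \<open>t\<close> equates the Hermitian forms of \<open>L2\<close> at
  \<open>y\<close> and of \<open>L3\<close> at \<open>u\<close>. The first estimate is then the real
  part of the same identity, the second comes from the coupling inequality.\<close>

lemma nonreal_eigenvalue_ratio:
  assumes "Im z \<noteq> 0"
  obtains t where "z * (complex_of_real s + t) = 1" "qmin * (cmod t)\<^sup>2 \<le> 2 * Re t" "1 \<le> gmax * (cmod t)\<^sup>2"
proof
  define t where "t = (1 - complex_of_real s * z) / z"
  have z0: "z \<noteq> 0" using assms by auto
  then show zt: "z * (complex_of_real s + t) = 1" by (simp add: t_def field_simps)
  have "Im t \<noteq> 0"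
  proof
    assume "Im t = 0"
    then have "complex_of_real s + t = complex_of_real (s + Re t)" by (simp add: complex_eq_iff)
    then have zr: "z * complex_of_real (s + Re t) = 1" using zt by simp
    have "Im z = 0" if "z * complex_of_real r = 1" for r
    proof -
      have "Im (z * complex_of_real r) = Im z * r" by simp
      then have "Im z * r = 0" unfolding that by simp
      moreover have "r \<noteq> 0" using that by auto
      ultimately show ?thesis by simp
    qed
    from this[OF zr] show False using assms by simp
  qed
  have e1: "cmat L2 *\<^sub>v y = t \<cdot>\<^sub>v (cmat Q *\<^sub>v y - cmat C\<^sup>T *\<^sub>v u)" unfolding t_def by (rule smult_eq_smult_imp[OF eq1 z0])
  have e2: "cmat L3 *\<^sub>v u = t \<cdot>\<^sub>v (cmat C *\<^sub>v y)" unfolding t_def by (rule smult_eq_smult_imp[OF eq2 z0])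
  define a where "a = hermitian_form L2 y"
  define b where "b = hermitian_form L3 u"
  define q where "q = hermitian_form Q y"
  define g where "g = conjugate u \<bullet> (cmat C *\<^sub>v y)"
  have cy: "conjugate y \<in> carrier_vec m" and cu: "conjugate u \<in> carrier_vec p" using y u by auto
  have "complex_of_real a = conjugate y \<bullet> (cmat L2 *\<^sub>v y)"
    unfolding a_def hermitian_form_def hermitian_form_real_mat[OF carriers(2) symmetric(3) y] ..
  also have "\<dots> = t * (conjugate y \<bullet> (cmat Q *\<^sub>v y) - conjugate y \<bullet> (cmat C\<^sup>T *\<^sub>v u))"
    unfolding e1 using cy complex_carriers by (simp add: scalar_prod_minus_distrib[of _ m])
  also have "\<dots> = t * (complex_of_real q - cnj g)"
    unfolding q_def hermitian_form_def hermitian_form_real_mat[OF carriers_Q_G(1) symmetric(1) y] g_def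
      conjugate_bilinear_transpose[OF carriers(5) y u] ..
  finally have a: "complex_of_real a = t * (complex_of_real q - cnj g)" .
  have "complex_of_real b = conjugate u \<bullet> (cmat L3 *\<^sub>v u)"
    unfolding b_def hermitian_form_def hermitian_form_real_mat[OF carriers(3) symmetric(4) u] ..
  also have "\<dots> = t * g" unfolding e2 g_def using cu complex_carriers by simp
  finally have b: "complex_of_real b = t * g" .
  \<comment> \<open>Multiplying by \<open>cnj t\<close> replaces the unknown coupling
    \<open>g\<close> by \<open>t g = b\<close>, which is real and so survives conjugation.\<close>
  have "complex_of_real a * cnj t = (t * cnj t) * complex_of_real q - t * cnj (t * g)"
    unfolding a by (simp add: algebra_simps)
  also have "\<dots> = complex_of_real ((cmod t)\<^sup>2 * q) - t * complex_of_real b"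
    unfolding b[symmetric] by (simp add: complex_norm_square[symmetric])
  finally have ab: "complex_of_real a * cnj t = complex_of_real ((cmod t)\<^sup>2 * q) - t * complex_of_real b" .
  have "a * Im t = b * Im t" using arg_cong[OF ab, of Im] by simp
  then have ba: "b = a" using \<open>Im t \<noteq> 0\<close> by simp
  have re: "2 * Re t * a = (cmod t)\<^sup>2 * q" using arg_cong[OF ab, of Re] by (simp add: ba algebra_simps)
  have a0: "a > 0"
  proof (cases "y = 0\<^sub>v m")
    case True
    then show ?thesis using hermitian_form_pos[OF L3 u] ne ba by (simp add: b_def)
  next
    case False
    then show ?thesis using hermitian_form_pos[OF L2 y] by (simp add: a_def)
  qed
  have "map_vec Re y \<in> carrier_vec m" "map_vec Im y \<in> carrier_vec m" using y by auto
  then have "qmin * a \<le> q"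
    unfolding a_def q_def hermitian_form_def using form_bounds(1) by (simp add: distrib_left add_mono)
  then have "(cmod t)\<^sup>2 * (qmin * a) \<le> 2 * Re t * a" unfolding re by (intro mult_left_mono) auto
  then have "(qmin * (cmod t)\<^sup>2) * a \<le> (2 * Re t) * a" by (simp add: mult_ac)
  then show "qmin * (cmod t)\<^sup>2 \<le> 2 * Re t" using a0 by (simp only: mult_le_cancel_right_pos)
  have ty: "t \<cdot>\<^sub>v y \<in> carrier_vec m" using y by simp
  \<comment> \<open>The complex factor \<open>t\<close> is moved into the vector, so that real and
    imaginary parts can be taken through the real matrices.\<close>
  have "cmat L3 *\<^sub>v u = cmat C *\<^sub>v (t \<cdot>\<^sub>v y)" unfolding e2 using y by (simp add: mult_mat_vec[of _ p m])
  then have L3u: "L3 *\<^sub>v map_vec Re u = C *\<^sub>v map_vec Re (t \<cdot>\<^sub>v y)" "L3 *\<^sub>v map_vec Im u = C *\<^sub>v map_vec Im (t \<cdot>\<^sub>v y)"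
    by (metis map_vec_Re_Im_mult carriers(3,5) u ty)+
  \<comment> \<open>Now the coupling term equals the form of \<open>L3\<close>, so one of its two
    copies cancels in \<open>coupling_le\<close>.\<close>
  have le: "u' \<bullet> (L3 *\<^sub>v u') \<le> gmax * (y' \<bullet> (L2 *\<^sub>v y'))"
    if "L3 *\<^sub>v u' = C *\<^sub>v y'" "y' \<in> carrier_vec m" "u' \<in> carrier_vec p" for u' y'
    using coupling_le[OF that(2,3)] unfolding that(1)[symmetric] by simp
  have "map_vec Re (t \<cdot>\<^sub>v y) \<in> carrier_vec m" "map_vec Im (t \<cdot>\<^sub>v y) \<in> carrier_vec m"
    "map_vec Re u \<in> carrier_vec p" "map_vec Im u \<in> carrier_vec p" using ty u by auto
  then have "b \<le> gmax * hermitian_form L2 (t \<cdot>\<^sub>v y)"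
    unfolding b_def hermitian_form_def distrib_left
    by (intro add_mono le L3u)
  also have "\<dots> = (gmax * (cmod t)\<^sup>2) * a"
    unfolding hermitian_form_smult[OF carriers(2) symmetric(3) y] a_def by simp
  finally have "1 * a \<le> (gmax * (cmod t)\<^sup>2) * a" unfolding ba by simp
  then show "1 \<le> gmax * (cmod t)\<^sup>2" using a0 by (simp only: mult_le_cancel_right_pos)
qed

end

end

section \<open>Block triangular form of the preconditioned matrix\<close>

context lpess
begin

section \<open>Action of the preconditioner and the saddle point matrix on block vectors\<close>

abbreviation "P \<equiv> LPESS_mat n p s A B C L2 L3"
abbreviation "S \<equiv> saddle_mat n m p A B C"

lemma P_S_carrier: "P \<in> carrier_mat (n + (m + p)) (n + (m + p))" "S \<in> carrier_mat (n + (m + p)) (n + (m + p))"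
  unfolding LPESS_mat_def saddle_mat_def by (intro block3_mat_carrier; simp)+

context
  fixes f :: "real \<Rightarrow> 'a :: comm_ring_1" and x y u :: "'a vec"
  assumes f: "comm_ring_hom f"
    and x: "x \<in> carrier_vec n" and y: "y \<in> carrier_vec m" and u: "u \<in> carrier_vec p"
begin

interpretation comm_ring_hom f by (rule f)

lemma block_products:
  "map_mat f A *\<^sub>v x \<in> carrier_vec n" "map_mat f B\<^sup>T *\<^sub>v y \<in> carrier_vec n"
  "map_mat f B *\<^sub>v x \<in> carrier_vec m" "map_mat f L2 *\<^sub>v y \<in> carrier_vec m"
  "map_mat f C\<^sup>T *\<^sub>v u \<in> carrier_vec m" "map_mat f C *\<^sub>v y \<in> carrier_vec p" "map_mat f L3 *\<^sub>v u \<in> carrier_vec p"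
  using x y u mult_mat_vec_carrier[of "map_mat f A" n n] mult_mat_vec_carrier[of "map_mat f (B\<^sup>T)" n m]
    mult_mat_vec_carrier[of "map_mat f B" m n] mult_mat_vec_carrier[of "map_mat f L2" m m]
    mult_mat_vec_carrier[of "map_mat f C\<^sup>T" m p] mult_mat_vec_carrier[of "map_mat f C" p m]
    mult_mat_vec_carrier[of "map_mat f L3" p p]
  by auto

lemma map_mat_simps:
  "map_mat f (c \<cdot>\<^sub>m M) = f c \<cdot>\<^sub>m map_mat f M" "map_mat f (- M) = - map_mat f M"
  "map_mat f (0\<^sub>m r k) = 0\<^sub>m r k"
  by (intro eq_matI; simp add: hom_distribs)+

lemma block_vec_simps:
  "(c \<cdot>\<^sub>m map_mat f A) *\<^sub>v x = c \<cdot>\<^sub>v (map_mat f A *\<^sub>v x)"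
  "(c \<cdot>\<^sub>m map_mat f B\<^sup>T) *\<^sub>v y = c \<cdot>\<^sub>v (map_mat f B\<^sup>T *\<^sub>v y)"
  "(c \<cdot>\<^sub>m map_mat f B) *\<^sub>v x = c \<cdot>\<^sub>v (map_mat f B *\<^sub>v x)"
  "(c \<cdot>\<^sub>m map_mat f C\<^sup>T) *\<^sub>v u = c \<cdot>\<^sub>v (map_mat f C\<^sup>T *\<^sub>v u)"
  "(c \<cdot>\<^sub>m map_mat f C) *\<^sub>v y = c \<cdot>\<^sub>v (map_mat f C *\<^sub>v y)"
  "(- (c \<cdot>\<^sub>m map_mat f B)) *\<^sub>v x = - (c \<cdot>\<^sub>v (map_mat f B *\<^sub>v x))"
  "(- (c \<cdot>\<^sub>m map_mat f C\<^sup>T)) *\<^sub>v u = - (c \<cdot>\<^sub>v (map_mat f C\<^sup>T *\<^sub>v u))"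
  "(- map_mat f B) *\<^sub>v x = - (map_mat f B *\<^sub>v x)"
  "(- map_mat f C\<^sup>T) *\<^sub>v u = - (map_mat f C\<^sup>T *\<^sub>v u)"
  "0\<^sub>m r n *\<^sub>v x = 0\<^sub>v r" "0\<^sub>m r m *\<^sub>v y = 0\<^sub>v r" "0\<^sub>m r p *\<^sub>v u = 0\<^sub>v r"
proof -
  have c: "map_mat f A \<in> carrier_mat n n" "map_mat f B\<^sup>T \<in> carrier_mat n m" "map_mat f B \<in> carrier_mat m n"
    "map_mat f C\<^sup>T \<in> carrier_mat m p" "map_mat f C \<in> carrier_mat p m"
    by auto
  note c' = smult_mat_mult_vec[OF c(1) x] smult_mat_mult_vec[OF c(2) y] smult_mat_mult_vec[OF c(3) x]
    smult_mat_mult_vec[OF c(4) u] smult_mat_mult_vec[OF c(5) y]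
  show "(c \<cdot>\<^sub>m map_mat f A) *\<^sub>v x = c \<cdot>\<^sub>v (map_mat f A *\<^sub>v x)"
    "(c \<cdot>\<^sub>m map_mat f B\<^sup>T) *\<^sub>v y = c \<cdot>\<^sub>v (map_mat f B\<^sup>T *\<^sub>v y)"
    "(c \<cdot>\<^sub>m map_mat f B) *\<^sub>v x = c \<cdot>\<^sub>v (map_mat f B *\<^sub>v x)"
    "(c \<cdot>\<^sub>m map_mat f C\<^sup>T) *\<^sub>v u = c \<cdot>\<^sub>v (map_mat f C\<^sup>T *\<^sub>v u)"
    "(c \<cdot>\<^sub>m map_mat f C) *\<^sub>v y = c \<cdot>\<^sub>v (map_mat f C *\<^sub>v y)"
    using c' by auto
  have d: "dim_vec x = dim_col B" "dim_vec u = dim_row C" using x u carrier_matD[OF carriers(4)] carrier_matD[OF carriers(5)] by auto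
  show "(- (c \<cdot>\<^sub>m map_mat f B)) *\<^sub>v x = - (c \<cdot>\<^sub>v (map_mat f B *\<^sub>v x))"
    "(- (c \<cdot>\<^sub>m map_mat f C\<^sup>T)) *\<^sub>v u = - (c \<cdot>\<^sub>v (map_mat f C\<^sup>T *\<^sub>v u))"
    "(- map_mat f B) *\<^sub>v x = - (map_mat f B *\<^sub>v x)"
    "(- map_mat f C\<^sup>T) *\<^sub>v u = - (map_mat f C\<^sup>T *\<^sub>v u)"
    using d c' by (simp_all add: uminus_mult_mat_vec)
  show "0\<^sub>m r n *\<^sub>v x = 0\<^sub>v r" "0\<^sub>m r m *\<^sub>v y = 0\<^sub>v r" "0\<^sub>m r p *\<^sub>v u = 0\<^sub>v r"
    using x y u by auto
qed

text \<open>One computation serves every ring homomorphism \<open>f\<close>: the identity gives the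
  real products behind invertibility and the first block column, \<open>complex_of_real\<close>
  those for complex eigenvectors.\<close>

lemma LPESS_mult_vec:
  "map_mat f P *\<^sub>v (x @\<^sub>v (y @\<^sub>v u)) =
    f s \<cdot>\<^sub>v (map_mat f A *\<^sub>v x + map_mat f B\<^sup>T *\<^sub>v y) @\<^sub>v
    ((map_mat f L2 *\<^sub>v y - f s \<cdot>\<^sub>v (map_mat f B *\<^sub>v x + map_mat f C\<^sup>T *\<^sub>v u)) @\<^sub>v
     (f s \<cdot>\<^sub>v (map_mat f C *\<^sub>v y) + map_mat f L3 *\<^sub>v u))"
proof -
  have "map_mat f P *\<^sub>v (x @\<^sub>v (y @\<^sub>v u)) =
    (map_mat f (s \<cdot>\<^sub>m A) *\<^sub>v x + (map_mat f (s \<cdot>\<^sub>m B\<^sup>T) *\<^sub>v y + map_mat f (0\<^sub>m n p) *\<^sub>v u)) @\<^sub>v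
    ((map_mat f (- (s \<cdot>\<^sub>m B)) *\<^sub>v x + (map_mat f L2 *\<^sub>v y + map_mat f (- (s \<cdot>\<^sub>m C\<^sup>T)) *\<^sub>v u)) @\<^sub>v
     (map_mat f (0\<^sub>m p n) *\<^sub>v x + (map_mat f (s \<cdot>\<^sub>m C) *\<^sub>v y + map_mat f L3 *\<^sub>v u)))"
    unfolding LPESS_mat_def by (rule block3_mat_mult_vec) (use x y u in auto)
  also have "\<dots> = (f s \<cdot>\<^sub>v (map_mat f A *\<^sub>v x) + (f s \<cdot>\<^sub>v (map_mat f B\<^sup>T *\<^sub>v y) + 0\<^sub>v n)) @\<^sub>v
    ((- (f s \<cdot>\<^sub>v (map_mat f B *\<^sub>v x)) + (map_mat f L2 *\<^sub>v y + - (f s \<cdot>\<^sub>v (map_mat f C\<^sup>T *\<^sub>v u)))) @\<^sub>v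
     (0\<^sub>v p + (f s \<cdot>\<^sub>v (map_mat f C *\<^sub>v y) + map_mat f L3 *\<^sub>v u)))"
    unfolding map_mat_simps block_vec_simps ..
  also have "\<dots> = f s \<cdot>\<^sub>v (map_mat f A *\<^sub>v x + map_mat f B\<^sup>T *\<^sub>v y) @\<^sub>v
    ((map_mat f L2 *\<^sub>v y - f s \<cdot>\<^sub>v (map_mat f B *\<^sub>v x + map_mat f C\<^sup>T *\<^sub>v u)) @\<^sub>v
     (f s \<cdot>\<^sub>v (map_mat f C *\<^sub>v y) + map_mat f L3 *\<^sub>v u))"
    unfolding block_arith(1)[OF block_products(1,2)] block_arith(2)[OF block_products(3,5,4)]
    using block_products(6,7) by simp
  finally show ?thesis .
qed

lemma saddle_mult_vec:
  "map_mat f S *\<^sub>v (x @\<^sub>v (y @\<^sub>v u)) =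
    (map_mat f A *\<^sub>v x + map_mat f B\<^sup>T *\<^sub>v y) @\<^sub>v
    (- (map_mat f B *\<^sub>v x + map_mat f C\<^sup>T *\<^sub>v u) @\<^sub>v (map_mat f C *\<^sub>v y))"
proof -
  have "map_mat f S *\<^sub>v (x @\<^sub>v (y @\<^sub>v u)) =
    (map_mat f A *\<^sub>v x + (map_mat f (B\<^sup>T) *\<^sub>v y + map_mat f (0\<^sub>m n p) *\<^sub>v u)) @\<^sub>v
    ((map_mat f (- B) *\<^sub>v x + (map_mat f (0\<^sub>m m m) *\<^sub>v y + map_mat f (- C\<^sup>T) *\<^sub>v u)) @\<^sub>v
     (map_mat f (0\<^sub>m p n) *\<^sub>v x + (map_mat f C *\<^sub>v y + map_mat f (0\<^sub>m p p) *\<^sub>v u)))"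
    unfolding saddle_mat_def by (rule block3_mat_mult_vec) (use x y u in auto)
  also have "\<dots> = (map_mat f A *\<^sub>v x + (map_mat f B\<^sup>T *\<^sub>v y + 0\<^sub>v n)) @\<^sub>v
    ((- (map_mat f B *\<^sub>v x) + (0\<^sub>v m + - (map_mat f C\<^sup>T *\<^sub>v u))) @\<^sub>v
     (0\<^sub>v p + (map_mat f C *\<^sub>v y + 0\<^sub>v p)))"
    unfolding map_mat_simps block_vec_simps ..
  also have "\<dots> = (map_mat f A *\<^sub>v x + map_mat f B\<^sup>T *\<^sub>v y) @\<^sub>v
    (- (map_mat f B *\<^sub>v x + map_mat f C\<^sup>T *\<^sub>v u) @\<^sub>v (map_mat f C *\<^sub>v y))"
    using block_arith(3)[OF block_products(3,5)] block_products(1,2,6) by simp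
  finally show ?thesis .
qed

end

lemma comm_ring_hom_ident: "comm_ring_hom (\<lambda>r :: real. r)"
  by unfold_locales auto

lemma map_mat_ident: "map_mat (\<lambda>r. r) M = M"
  by (intro eq_matI) auto

lemmas real_LPESS_mult_vec = LPESS_mult_vec[OF comm_ring_hom_ident, unfolded map_mat_ident]
lemmas real_saddle_mult_vec = saddle_mult_vec[OF comm_ring_hom_ident, unfolded map_mat_ident]
lemmas real_block_products = block_products[OF comm_ring_hom_ident, unfolded map_mat_ident]

text \<open>Pairing the block rows with \<open>x\<close>, \<open>y\<close> and \<open>u\<close> and
  adding, the off-diagonal terms cancel by skew symmetry. What remains is a vanishing sum of three
  nonnegative definite forms.\<close>

lemma LPESS_injective:
  assumes v: "v \<in> carrier_vec (n + (m + p))" and Pv: "P *\<^sub>v v = 0\<^sub>v (n + (m + p))"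
  shows "v = 0\<^sub>v (n + (m + p))"
proof -
  obtain x w where x: "x \<in> carrier_vec n" and w: "w \<in> carrier_vec (m + p)" and vxw: "v = x @\<^sub>v w"
    using append_vec_split[OF v] .
  obtain y u where y: "y \<in> carrier_vec m" and u: "u \<in> carrier_vec p" and wyu: "w = y @\<^sub>v u"
    using append_vec_split[OF w] .
  note c = real_block_products[OF x y u]
  have "s \<cdot>\<^sub>v (A *\<^sub>v x + B\<^sup>T *\<^sub>v y) @\<^sub>v
    ((L2 *\<^sub>v y - s \<cdot>\<^sub>v (B *\<^sub>v x + C\<^sup>T *\<^sub>v u)) @\<^sub>v (s \<cdot>\<^sub>v (C *\<^sub>v y) + L3 *\<^sub>v u))
    = 0\<^sub>v n @\<^sub>v (0\<^sub>v m @\<^sub>v 0\<^sub>v p)"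
    using Pv unfolding vxw wyu real_LPESS_mult_vec[OF x y u] by (simp add: zero_append_vec)
  then have e: "s \<cdot>\<^sub>v (A *\<^sub>v x + B\<^sup>T *\<^sub>v y) = 0\<^sub>v n" "L2 *\<^sub>v y - s \<cdot>\<^sub>v (B *\<^sub>v x + C\<^sup>T *\<^sub>v u) = 0\<^sub>v m"
    "s \<cdot>\<^sub>v (C *\<^sub>v y) + L3 *\<^sub>v u = 0\<^sub>v p"
    using c by (simp_all add: append_vec_eq[of _ n] append_vec_eq[of _ m])
  have "s * (x \<bullet> (A *\<^sub>v x) + x \<bullet> (B\<^sup>T *\<^sub>v y)) = 0"
    using arg_cong[OF e(1), of "\<lambda>w. x \<bullet> w"] x c by (simp add: scalar_prod_add_distrib[of _ n])
  moreover have "y \<bullet> (L2 *\<^sub>v y) - s * (y \<bullet> (B *\<^sub>v x) + y \<bullet> (C\<^sup>T *\<^sub>v u)) = 0"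
    using arg_cong[OF e(2), of "\<lambda>w. y \<bullet> w"] y c
    by (simp add: scalar_prod_add_distrib[of _ m] scalar_prod_minus_distrib[of _ m])
  moreover have "s * (u \<bullet> (C *\<^sub>v y)) + u \<bullet> (L3 *\<^sub>v u) = 0"
    using arg_cong[OF e(3), of "\<lambda>w. u \<bullet> w"] u c by (simp add: scalar_prod_add_distrib[of _ p])
  moreover have "x \<bullet> (B\<^sup>T *\<^sub>v y) = y \<bullet> (B *\<^sub>v x)" "y \<bullet> (C\<^sup>T *\<^sub>v u) = u \<bullet> (C *\<^sub>v y)"
    using bilinear_transpose[OF carriers(4) y x] bilinear_transpose[OF carriers(5) u y] by simp_all
  ultimately have "s * (x \<bullet> (A *\<^sub>v x)) + y \<bullet> (L2 *\<^sub>v y) + u \<bullet> (L3 *\<^sub>v u) = 0"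
    by (simp add: algebra_simps)
  moreover have "x \<bullet> (A *\<^sub>v x) \<ge> 0"
    using sym_pos_def_imp_psd[OF A] x by (simp add: sym_psd_def)
  then have "s * (x \<bullet> (A *\<^sub>v x)) \<ge> 0" using s by simp
  moreover note form_nonneg(2)[OF y] form_nonneg(3)[OF u]
  ultimately have "s * (x \<bullet> (A *\<^sub>v x)) = 0" "y \<bullet> (L2 *\<^sub>v y) = 0" "u \<bullet> (L3 *\<^sub>v u) = 0"
    by linarith+
  then have "x = 0\<^sub>v n" "y = 0\<^sub>v m" "u = 0\<^sub>v p"
    using s A x form_pos(2)[OF y] form_pos(3)[OF u] by (auto simp: sym_pos_def_def)
  then show ?thesis unfolding vxw wyu by (simp add: zero_append_vec)
qed

section \<open>The preconditioned matrix and its trailing block\<close>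

abbreviation "M \<equiv> mat_inv P * S"

lemma M_carrier: "M \<in> carrier_mat (n + (m + p)) (n + (m + p))"
  using mat_inv_injective(1)[OF P_S_carrier(1) LPESS_injective] P_S_carrier(2) by simp

lemma P_M: "P * M = S"
proof -
  note I = mat_inv_injective[OF P_S_carrier(1) LPESS_injective]
  have "P * M = (P * mat_inv P) * S" using I(1) P_S_carrier by (intro assoc_mult_mat[symmetric])
  then show ?thesis using I(2) P_S_carrier by simp
qed

text \<open>On vectors supported in the first block, \<open>P\<close> acts as \<open>s\<close> times
  \<open>S\<close>; applying the inverse of \<open>P\<close> gives the factor
  \<open>1 / s\<close>.\<close>

lemma M_first_block:
  assumes x: "x \<in> carrier_vec n"
  shows "M *\<^sub>v (x @\<^sub>v 0\<^sub>v (m + p)) = (1 / s) \<cdot>\<^sub>v (x @\<^sub>v 0\<^sub>v (m + p))"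
proof -
  note I = mat_inv_injective[OF P_S_carrier(1) LPESS_injective]
  let ?e = "x @\<^sub>v (0\<^sub>v m @\<^sub>v 0\<^sub>v p)"
  have e: "?e \<in> carrier_vec (n + (m + p))" using x by auto
  have z: "0\<^sub>v m \<in> carrier_vec m" "0\<^sub>v p \<in> carrier_vec p" by auto
  note c = real_block_products[OF x z]
  have tr: "B\<^sup>T \<in> carrier_mat n m" "C\<^sup>T \<in> carrier_mat m p" by auto
  note zero = mult_mat_zero_vec[OF tr(1)] mult_mat_zero_vec[OF tr(2)] mult_mat_zero_vec[OF carriers(5)]
    mult_mat_zero_vec[OF carriers(2)] mult_mat_zero_vec[OF carriers(3)]
  have Se: "S *\<^sub>v ?e = A *\<^sub>v x @\<^sub>v (- (B *\<^sub>v x) @\<^sub>v 0\<^sub>v p)"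
    unfolding real_saddle_mult_vec[OF x z] zero using c by simp
  have smult_zero: "s \<cdot>\<^sub>v 0\<^sub>v p = 0\<^sub>v p" "s \<cdot>\<^sub>v 0\<^sub>v m = 0\<^sub>v m" by (intro eq_vecI; simp)+
  have Pe: "P *\<^sub>v ?e = s \<cdot>\<^sub>v (A *\<^sub>v x) @\<^sub>v (- (s \<cdot>\<^sub>v (B *\<^sub>v x)) @\<^sub>v 0\<^sub>v p)"
    unfolding real_LPESS_mult_vec[OF x z] zero using c by (simp add: smult_zero)
  have "S *\<^sub>v ?e = (1 / s) \<cdot>\<^sub>v (P *\<^sub>v ?e)"
    unfolding Se Pe append_vec_smult using s
    by (intro arg_cong2[of _ _ _ _ append_vec] eq_vecI) auto
  moreover have "M *\<^sub>v ?e = mat_inv P *\<^sub>v (S *\<^sub>v ?e)"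
    using assoc_mult_mat_vec[OF I(1) P_S_carrier(2) e] .
  ultimately have "M *\<^sub>v ?e = (1 / s) \<cdot>\<^sub>v (mat_inv P *\<^sub>v (P *\<^sub>v ?e))"
    using mult_mat_vec[OF I(1), of "P *\<^sub>v ?e"] mult_mat_vec_carrier[OF P_S_carrier(1) e] by simp
  then show ?thesis
    using mat_inv_cancel(2)[OF P_S_carrier(1) LPESS_injective e] by (simp add: zero_append_vec)
qed

lemma M_block_triangular:
  obtains X Y where "X \<in> carrier_mat n (m + p)" "Y \<in> carrier_mat (m + p) (m + p)"
    "M = four_block_mat ((1 / s) \<cdot>\<^sub>m 1\<^sub>m n) X (0\<^sub>m (m + p) n) Y"
proof -
  obtain W X Z Y where sp: "split_block M n n = (W, X, Z, Y)" by (metis prod_cases4)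
  note blk = split_block[OF sp, of "m + p" "m + p"]
  have d: "dim_row M = n + (m + p)" "dim_col M = n + (m + p)" using M_carrier by blast+
  have entry: "M $$ (i, j) = (if i = j then 1 / s else 0)" if ij: "i < n + (m + p)" "j < n" for i j
  proof -
    \<comment> \<open>The padded unit vector is the \<open>j\<close>-th unit vector of the full
      space, so the product is column \<open>j\<close> of \<open>M\<close>.\<close>
    have "M $$ (i, j) = (M *\<^sub>v (unit_vec n j @\<^sub>v 0\<^sub>v (m + p))) $ i"
    proof -
      have "unit_vec n j @\<^sub>v 0\<^sub>v (m + p) = (unit_vec (n + (m + p)) j :: real vec)"
        using ij by (intro eq_vecI) auto
      then show ?thesis using ij d by simp
    qed
    also have "\<dots> = ((1 / s) \<cdot>\<^sub>v (unit_vec n j @\<^sub>v 0\<^sub>v (m + p))) $ i" by (subst M_first_block) auto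
    also have "\<dots> = (if i = j then 1 / s else 0)" using ij by auto
    finally show ?thesis .
  qed
  have "W = (1 / s) \<cdot>\<^sub>m 1\<^sub>m n" "Z = 0\<^sub>m (m + p) n"
    using sp d unfolding split_block_def Let_def by (auto intro!: eq_matI simp: entry simp del: index_mult_mat)
  with blk d that show thesis by blast
qed

text \<open>An eigenvector \<open>w\<close> of \<open>Y\<close> is padded to \<open>(0, w)\<close>,
  which \<open>M\<close> sends to \<open>(X w, z w)\<close>. Reading \<open>S = P M\<close> on this
  vector gives three block equations, from which \<open>x = X w\<close> is eliminated. Since
  \<open>(0, w)\<close> need not be an eigenvector of \<open>M\<close>, no case distinction on
  \<open>z = 1 / s\<close> arises.\<close>

lemma eigvals_mset_decomposition:
  obtains Y where "Y \<in> carrier_mat (m + p) (m + p)"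
    "eigvals_mset M = replicate_mset n (complex_of_real (1 / s)) + eigvals_mset Y"
    "\<And>z. z \<in># eigvals_mset Y \<Longrightarrow> \<exists>y \<in> carrier_vec m. \<exists>u \<in> carrier_vec p. (y \<noteq> 0\<^sub>v m \<or> u \<noteq> 0\<^sub>v p) \<and>
      z \<cdot>\<^sub>v (cmat L2 *\<^sub>v y) = (1 - complex_of_real s * z) \<cdot>\<^sub>v (cmat Q *\<^sub>v y - cmat C\<^sup>T *\<^sub>v u) \<and>
      z \<cdot>\<^sub>v (cmat L3 *\<^sub>v u) = (1 - complex_of_real s * z) \<cdot>\<^sub>v (cmat C *\<^sub>v y)"
proof -
  obtain X Y where X: "X \<in> carrier_mat n (m + p)" and Y: "Y \<in> carrier_mat (m + p) (m + p)"
    and M: "M = four_block_mat ((1 / s) \<cdot>\<^sub>m 1\<^sub>m n) X (0\<^sub>m (m + p) n) Y"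
    using M_block_triangular .
  show thesis
  proof (rule that[OF Y])
    show "eigvals_mset M = replicate_mset n (complex_of_real (1 / s)) + eigvals_mset Y"
      unfolding M by (rule eigvals_mset_block_upper_triangular[OF X Y])
    fix z assume "z \<in># eigvals_mset Y"
    have cX: "cmat X \<in> carrier_mat n (m + p)" and cY: "cmat Y \<in> carrier_mat (m + p) (m + p)" using X Y by auto
    have "char_poly (cmat Y) \<noteq> 0" using degree_monic_char_poly[OF cY] by auto
    then have "poly (char_poly (cmat Y)) z = 0"
      using \<open>z \<in># eigvals_mset Y\<close> by (simp add: eigvals_mset_def)
    then have "eigenvalue (cmat Y) z" using eigenvalue_root_char_poly[OF cY] by simp
    then obtain w where w: "w \<in> carrier_vec (m + p)" "w \<noteq> 0\<^sub>v (m + p)" "cmat Y *\<^sub>v w = z \<cdot>\<^sub>v w"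
      unfolding eigenvalue_def eigenvector_def using cY by auto
    obtain y u where y: "y \<in> carrier_vec m" and u: "u \<in> carrier_vec p" and wyu: "w = y @\<^sub>v u"
      using append_vec_split[OF w(1)] .
    define x where "x = cmat X *\<^sub>v w"
    have x: "x \<in> carrier_vec n" unfolding x_def by (rule mult_mat_vec_carrier[OF cX w(1)])
    have zy: "z \<cdot>\<^sub>v y \<in> carrier_vec m" and zu: "z \<cdot>\<^sub>v u \<in> carrier_vec p" using y u by auto
    have z0: "(0\<^sub>v n :: complex vec) \<in> carrier_vec n" by simp
    let ?v = "0\<^sub>v n @\<^sub>v (y @\<^sub>v u)"
    have v: "?v \<in> carrier_vec (n + (m + p))" using y u by auto
    have cM: "cmat M = four_block_mat (cmat ((1 / s) \<cdot>\<^sub>m 1\<^sub>m n)) (cmat X) (0\<^sub>m (m + p) n) (cmat Y)"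
      unfolding M using X Y
      by (subst map_four_block_mat[of _ n n _ "m + p" _ "m + p"]) (auto intro!: cong_four_block_mat)
    have Mv: "cmat M *\<^sub>v ?v = x @\<^sub>v (z \<cdot>\<^sub>v y @\<^sub>v z \<cdot>\<^sub>v u)"
    proof -
      have I: "cmat ((1 / s) \<cdot>\<^sub>m 1\<^sub>m n) \<in> carrier_mat n n" by simp
      have "cmat M *\<^sub>v (0\<^sub>v n @\<^sub>v w) = (cmat ((1 / s) \<cdot>\<^sub>m 1\<^sub>m n) *\<^sub>v 0\<^sub>v n + cmat X *\<^sub>v w) @\<^sub>v
        (0\<^sub>m (m + p) n *\<^sub>v 0\<^sub>v n + cmat Y *\<^sub>v w)"
        unfolding cM by (rule four_block_mat_mult_vec[OF I cX zero_carrier_mat cY z0 w(1)])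
      also have "\<dots> = x @\<^sub>v z \<cdot>\<^sub>v w"
        unfolding mult_mat_zero_vec[OF I] mult_mat_zero_vec[OF zero_carrier_mat] w(3) x_def[symmetric]
        using x w(1) by simp
      finally show ?thesis unfolding wyu append_vec_smult .
    qed
    have "cmat S = cmat P * cmat M"
      using of_real_hom.mat_hom_mult[OF P_S_carrier(1) M_carrier] unfolding P_M .
    then have "cmat S *\<^sub>v ?v = cmat P *\<^sub>v (cmat M *\<^sub>v ?v)"
      using assoc_mult_mat_vec[of "cmat P" "n + (m + p)" "n + (m + p)" "cmat M" "n + (m + p)" ?v]
        P_S_carrier M_carrier v by simp
    then have blocks: "cmat S *\<^sub>v (0\<^sub>v n @\<^sub>v (y @\<^sub>v u)) = cmat P *\<^sub>v (x @\<^sub>v (z \<cdot>\<^sub>v y @\<^sub>v z \<cdot>\<^sub>v u))"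
      unfolding Mv .
    have h: "comm_ring_hom complex_of_real" ..
    note c = block_products[OF h z0 y u] block_products[OF h x zy zu]
    have cA: "cmat A \<in> carrier_mat n n" and cB: "cmat B \<in> carrier_mat m n" and cBt: "cmat B\<^sup>T \<in> carrier_mat n m"
      and cC: "cmat C \<in> carrier_mat p m" and cCt: "cmat C\<^sup>T \<in> carrier_mat m p"
      and cL2: "cmat L2 \<in> carrier_mat m m" and cL3: "cmat L3 \<in> carrier_mat p p" by auto
    note smult = mult_mat_vec[OF cBt y] mult_mat_vec[OF cC y] mult_mat_vec[OF cCt u]
      mult_mat_vec[OF cL2 y] mult_mat_vec[OF cL3 u]
    have e: "0\<^sub>v n + cmat B\<^sup>T *\<^sub>v y = complex_of_real s \<cdot>\<^sub>v (cmat A *\<^sub>v x + z \<cdot>\<^sub>v (cmat B\<^sup>T *\<^sub>v y))"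
      "- (0\<^sub>v m + cmat C\<^sup>T *\<^sub>v u) = z \<cdot>\<^sub>v (cmat L2 *\<^sub>v y) -
        complex_of_real s \<cdot>\<^sub>v (cmat B *\<^sub>v x + z \<cdot>\<^sub>v (cmat C\<^sup>T *\<^sub>v u))"
      "cmat C *\<^sub>v y = complex_of_real s \<cdot>\<^sub>v (z \<cdot>\<^sub>v (cmat C *\<^sub>v y)) + z \<cdot>\<^sub>v (cmat L3 *\<^sub>v u)"
      using blocks c
      unfolding saddle_mult_vec[OF h z0 y u] LPESS_mult_vec[OF h x zy zu]
        mult_mat_zero_vec[OF cA] mult_mat_zero_vec[OF cB] smult
      by (simp_all add: append_vec_eq[of _ n] append_vec_eq[of _ m])
    let ?mu = "1 - complex_of_real s * z"
    \<comment> \<open>The three auxiliary facts rearrange the three block rows, collecting the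
      factor \<open>1 - s z\<close>; the second also replaces \<open>s B x\<close> by its value in
      terms of \<open>Q y\<close>.\<close>
    have step1: "s' \<cdot>\<^sub>v a = (1 - s' * z) \<cdot>\<^sub>v b"
      if "0\<^sub>v k + b = s' \<cdot>\<^sub>v (a + z \<cdot>\<^sub>v b)" "a \<in> carrier_vec k" "b \<in> carrier_vec k"
      for s' and a b :: "complex vec" and k
    proof (rule eq_vecI)
      fix i assume "i < dim_vec ((1 - s' * z) \<cdot>\<^sub>v b)"
      then show "(s' \<cdot>\<^sub>v a) $ i = ((1 - s' * z) \<cdot>\<^sub>v b) $ i"
        using arg_cong[OF that(1), of "\<lambda>w. w $ i"] that(2,3) by (simp add: algebra_simps)
    qed (use that in simp)
    have step2: "z \<cdot>\<^sub>v a = (1 - s' * z) \<cdot>\<^sub>v (q - b)"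
      if "- (0\<^sub>v k + b) = z \<cdot>\<^sub>v a - s' \<cdot>\<^sub>v (d + z \<cdot>\<^sub>v b)" "s' \<cdot>\<^sub>v d = (1 - s' * z) \<cdot>\<^sub>v q"
        "a \<in> carrier_vec k" "b \<in> carrier_vec k" "d \<in> carrier_vec k" "q \<in> carrier_vec k"
      for s' and a b d q :: "complex vec" and k
    proof (rule eq_vecI)
      fix i assume "i < dim_vec ((1 - s' * z) \<cdot>\<^sub>v (q - b))"
      then have i: "i < k" using that(4) by simp
      have "z * a $ i = s' * d $ i + (s' * z - 1) * b $ i"
        using arg_cong[OF that(1), of "\<lambda>w. w $ i"] that(3-5) i by (simp add: algebra_simps)
      also have "s' * d $ i = (1 - s' * z) * q $ i"
        using arg_cong[OF that(2), of "\<lambda>w. w $ i"] that(5,6) i by simp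
      finally show "(z \<cdot>\<^sub>v a) $ i = ((1 - s' * z) \<cdot>\<^sub>v (q - b)) $ i"
        using that(3-6) i by (simp add: algebra_simps)
    qed (use that in simp)
    have step3: "z \<cdot>\<^sub>v a = (1 - s' * z) \<cdot>\<^sub>v b"
      if "b = s' \<cdot>\<^sub>v (z \<cdot>\<^sub>v b) + z \<cdot>\<^sub>v a" "a \<in> carrier_vec k" "b \<in> carrier_vec k"
      for s' and a b :: "complex vec" and k
    proof (rule eq_vecI)
      fix i assume "i < dim_vec ((1 - s' * z) \<cdot>\<^sub>v b)"
      then show "(z \<cdot>\<^sub>v a) $ i = ((1 - s' * z) \<cdot>\<^sub>v b) $ i"
        using arg_cong[OF that(1), of "\<lambda>w. w $ i"] that(2,3) by (simp add: algebra_simps)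
    qed (use that in simp)
    note IA = mat_inv_injective[OF carriers(1) sym_pos_def_injective[OF A]]
    have cI: "cmat (mat_inv A) \<in> carrier_mat n n" using IA(1) by simp
    have cancel: "cmat (mat_inv A) *\<^sub>v (cmat A *\<^sub>v x) = x"
    proof -
      have "cmat (mat_inv A) * cmat A = 1\<^sub>m n"
        using of_real_hom.mat_hom_mult[OF IA(1) carriers(1)] IA(3) of_real_hom.mat_hom_one by metis
      then show ?thesis using assoc_mult_mat_vec[OF cI cA x] x by simp
    qed
    \<comment> \<open>Inverting \<open>A\<close> in the first row and then applying \<open>B\<close>
      expresses \<open>s B x\<close> through \<open>Q y\<close>, without dividing by
      \<open>1 - s z\<close>.\<close>
    have Ax: "complex_of_real s \<cdot>\<^sub>v (cmat A *\<^sub>v x) = ?mu \<cdot>\<^sub>v (cmat B\<^sup>T *\<^sub>v y)"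
      by (rule step1[OF e(1)]) (use c in auto)
    have "complex_of_real s \<cdot>\<^sub>v x = ?mu \<cdot>\<^sub>v (cmat (mat_inv A) *\<^sub>v (cmat B\<^sup>T *\<^sub>v y))"
      using arg_cong[OF Ax, of "\<lambda>w. cmat (mat_inv A) *\<^sub>v w"] c
      unfolding mult_mat_vec[OF cI c(8)] mult_mat_vec[OF cI c(2)] cancel by simp
    then have "complex_of_real s \<cdot>\<^sub>v (cmat B *\<^sub>v x) =
      ?mu \<cdot>\<^sub>v (cmat B *\<^sub>v (cmat (mat_inv A) *\<^sub>v (cmat B\<^sup>T *\<^sub>v y)))"
      using mult_mat_vec[OF cB x] mult_mat_vec[OF cB mult_mat_vec_carrier[OF cI c(2)]] by metis
    also have "cmat B *\<^sub>v (cmat (mat_inv A) *\<^sub>v (cmat B\<^sup>T *\<^sub>v y)) = cmat Q *\<^sub>v y"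
    proof -
      have BI: "B * mat_inv A \<in> carrier_mat m n" by (rule mult_carrier_mat[OF carriers(4) IA(1)])
      have Bt: "B\<^sup>T \<in> carrier_mat n m" by simp
      have "cmat Q = cmat B * cmat (mat_inv A) * cmat B\<^sup>T"
      proof -
        have "cmat (B * mat_inv A) = cmat B * cmat (mat_inv A)"
          by (rule of_real_hom.mat_hom_mult[OF carriers(4) IA(1)])
        then show ?thesis unfolding Q_def of_real_hom.mat_hom_mult[OF BI Bt] by simp
      qed
      then show ?thesis
        using assoc_mult_mat_vec[OF mult_carrier_mat[OF cB cI] cBt y] assoc_mult_mat_vec[OF cB cI c(2)] by simp
    qed
    finally have Bx: "complex_of_real s \<cdot>\<^sub>v (cmat B *\<^sub>v x) = ?mu \<cdot>\<^sub>v (cmat Q *\<^sub>v y)" .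
    have Qy: "cmat Q *\<^sub>v y \<in> carrier_vec m" using y by (intro mult_mat_vec_carrier[of _ m m]) auto
    have "y \<noteq> 0\<^sub>v m \<or> u \<noteq> 0\<^sub>v p" using w(2) unfolding wyu by (auto simp: zero_append_vec)
    moreover have "z \<cdot>\<^sub>v (cmat L2 *\<^sub>v y) = ?mu \<cdot>\<^sub>v (cmat Q *\<^sub>v y - cmat C\<^sup>T *\<^sub>v u)"
      by (rule step2[OF e(2) Bx c(4,5,10) Qy])
    moreover have "z \<cdot>\<^sub>v (cmat L3 *\<^sub>v u) = ?mu \<cdot>\<^sub>v (cmat C *\<^sub>v y)"
      by (rule step3[OF e(3) c(7,6)])
    ultimately show "\<exists>y \<in> carrier_vec m. \<exists>u \<in> carrier_vec p. (y \<noteq> 0\<^sub>v m \<or> u \<noteq> 0\<^sub>v p) \<and>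
      z \<cdot>\<^sub>v (cmat L2 *\<^sub>v y) = ?mu \<cdot>\<^sub>v (cmat Q *\<^sub>v y - cmat C\<^sup>T *\<^sub>v u) \<and>
      z \<cdot>\<^sub>v (cmat L3 *\<^sub>v u) = ?mu \<cdot>\<^sub>v (cmat C *\<^sub>v y)"
      using y u by blast
  qed
qed

end

section \<open>Transfer of the reduced estimates to the remaining \<open>m + p\<close>
  eigenvalues\<close>

theorem theorem5p1:
  fixes n m p :: nat and s :: real and A B C \<Lambda>2 \<Lambda>3 :: "real mat"
  defines "M \<equiv> mat_inv (LPESS_mat n p s A B C \<Lambda>2 \<Lambda>3) * saddle_mat n m p A B C"
  defines "Q \<equiv> B * mat_inv A * B\<^sup>T"
  defines "\<theta>max \<equiv> lambda_max (mat_inv \<Lambda>2 * Q)"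
  defines "\<theta>min \<equiv> lambda_min (mat_inv \<Lambda>2 * Q)"
  defines "t\<theta>max \<equiv> lambda_max (mat_inv \<Lambda>3 * C * mat_inv \<Lambda>2 * C\<^sup>T)"
  defines "t\<theta>min \<equiv> lambda_min (mat_inv \<Lambda>3 * C * mat_inv \<Lambda>2 * C\<^sup>T)"
  defines "N \<equiv> replicate_mset n (complex_of_real (1 / s))"
  defines "R \<equiv> eigvals_mset M - N"
  assumes "n > 0" and "m > 0" and "p > 0"
    and "sym_pos_def n A" and "sym_pos_def m \<Lambda>2" and "sym_pos_def p \<Lambda>3"
    and "full_row_rank m n B" and "full_row_rank p m C"
    and "s > 0"
  shows "N \<subseteq># eigvals_mset M \<and> size R = m + p \<and>
    (\<forall>z. z \<in># R \<and> Im z = 0 \<longrightarrow>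
       Re z \<in> {min (\<theta>min / (1 + s * \<theta>min)) (t\<theta>min / (\<theta>max + s * t\<theta>min)) ..
               \<theta>max / (1 + s * \<theta>max)}) \<and>
    (\<forall>z. z \<in># R \<and> Im z \<noteq> 0 \<longrightarrow>
       \<theta>min / (2 + s * \<theta>min) \<le> cmod z \<and>
       cmod z \<le> sqrt (t\<theta>max / (1 + s * \<theta>min + s\<^sup>2 * t\<theta>max)) \<and>
       1 / (s * (1 + s * sqrt t\<theta>max)) \<le> cmod (z - complex_of_real (1 / s)) \<and>
       cmod (z - complex_of_real (1 / s)) \<le> 2 / (s * (2 + s * \<theta>min)))"
proof -
  interpret l: lpess n m p s A B C \<Lambda>2 \<Lambda>3 using assms by unfold_locales
  have I2: "mat_inv \<Lambda>2 \<in> carrier_mat m m"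
    by (rule mat_inv_injective(1)[OF l.carriers(2) sym_pos_def_injective[OF l.L2]])
  have I3: "mat_inv \<Lambda>3 \<in> carrier_mat p p"
    by (rule mat_inv_injective(1)[OF l.carriers(3) sym_pos_def_injective[OF l.L3]])
  have \<theta>: "\<theta>min = l.qmin" "\<theta>max = l.qmax"
    unfolding \<theta>min_def \<theta>max_def l.qmin_def l.qmax_def l.Q_def Q_def by simp_all
  \<comment> \<open>Regrouping the product exhibits it as the pencil of \<open>G\<close> and
    \<open>\<Lambda>3\<close>.\<close>
  have "mat_inv \<Lambda>3 * C * mat_inv \<Lambda>2 * C\<^sup>T = mat_inv \<Lambda>3 * l.G"
    unfolding l.G_def
    using assoc_mult_mat[OF I3 l.carriers(5) I2] assoc_mult_mat[OF I3 mult_carrier_mat[OF l.carriers(5) I2], of "C\<^sup>T" p]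
    by simp
  then have t\<theta>: "t\<theta>min = l.gmin" "t\<theta>max = l.gmax"
    unfolding t\<theta>min_def t\<theta>max_def l.gmin_def l.gmax_def by simp_all
  obtain Y where Y: "Y \<in> carrier_mat (m + p) (m + p)"
    and M: "eigvals_mset M = N + eigvals_mset Y"
    and ev: "\<And>z. z \<in># eigvals_mset Y \<Longrightarrow> \<exists>y \<in> carrier_vec m. \<exists>u \<in> carrier_vec p. (y \<noteq> 0\<^sub>v m \<or> u \<noteq> 0\<^sub>v p) \<and>
      z \<cdot>\<^sub>v (l.cmat \<Lambda>2 *\<^sub>v y) = (1 - complex_of_real s * z) \<cdot>\<^sub>v (l.cmat l.Q *\<^sub>v y - l.cmat C\<^sup>T *\<^sub>v u) \<and>
      z \<cdot>\<^sub>v (l.cmat \<Lambda>3 *\<^sub>v u) = (1 - complex_of_real s * z) \<cdot>\<^sub>v (l.cmat C *\<^sub>v y)"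
    using l.eigvals_mset_decomposition unfolding M_def N_def by blast
  \<comment> \<open>The multiset is \<open>N\<close> plus that of \<open>Y\<close>, so the
    subtraction in \<open>R\<close> is not truncated.\<close>
  have R: "R = eigvals_mset Y" unfolding R_def M by simp
  have "size R = m + p"
    unfolding R eigvals_mset_def size_proots_complex
    using degree_monic_char_poly[of "l.cmat Y" "m + p"] Y by simp
  moreover have "Re z \<in> {min (\<theta>min / (1 + s * \<theta>min)) (t\<theta>min / (\<theta>max + s * t\<theta>min)) .. \<theta>max / (1 + s * \<theta>max)}"
    if "z \<in># R" "Im z = 0" for z
    using ev[OF that(1)[unfolded R]] l.real_eigenvalue_bounds[OF _ _ _ _ _ that(2)] unfolding \<theta> t\<theta> by blast
  moreover have "\<theta>min / (2 + s * \<theta>min) \<le> cmod z \<and>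
      cmod z \<le> sqrt (t\<theta>max / (1 + s * \<theta>min + s\<^sup>2 * t\<theta>max)) \<and>
      1 / (s * (1 + s * sqrt t\<theta>max)) \<le> cmod (z - complex_of_real (1 / s)) \<and>
      cmod (z - complex_of_real (1 / s)) \<le> 2 / (s * (2 + s * \<theta>min))"
    if z: "z \<in># R" "Im z \<noteq> 0" for z
  proof -
    obtain t where "z * (complex_of_real s + t) = 1" "l.qmin * (cmod t)\<^sup>2 \<le> 2 * Re t" "1 \<le> l.gmax * (cmod t)\<^sup>2"
      using ev[OF z(1)[unfolded R]] l.nonreal_eigenvalue_ratio[OF _ _ _ _ _ z(2)] by blast
    from nonreal_eigenvalue_estimates[OF this(1) l.s l.extremes_pos(1,4) this(2,3)]
    show ?thesis unfolding \<theta> t\<theta> by blast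
  qed
  ultimately show ?thesis unfolding M by auto
qed

end
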